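(* Let $0<\varepsilon\le 1/d$ and $\mathcal{Y}=[\varepsilon,1]^d\cap\Delta_{d-1}$, where $\Delta_{d-1}=\{p\in\mathbb{R}^d: p_i\ge 0,\ \sum_{i=1}^d p_i=1\}$. Consider an adaptive random scan Metropolis-within-Gibbs sampler (AdapRSMwG) for $\pi$ with fixed proposals, whose selection probabilities satisfy $\alpha_n\in\mathcal{Y}$ for all $n$. Assume that (a) for the fixed starting values $x_0\in\mathcal{X}$ and $\alpha_0\in\mathcal{Y}$, $|\alpha_n-\alpha_{n-1}|\to 0$ in probability as $n\to\infty$; (b) there exists $\beta\in\mathcal{Y}$ such that the random scan Gibbs sampler RSG($\beta$) is uniformly ergodic; (c) for every $i\in\{1,\dots,d\}$ the Metropolis kernel $P_{x_{-i}}$ on $\mathcal{X}_i$ is uniformly ergodic for every $x_{-i}\in\mathcal{X}_{-i}$, and moreover there exist $s_i>0$ and an integer $m_i$ such that for every $x_{-i}\in\mathcal{X}_{-i}$ there is a probability measure $\nu_{x_{-i}}$ on $(\mathcal{X}_i,\mathcal{B}(\mathcal{X}_i))$ with $$P_{x_{-i}}^{m_i}(x_i,\cdot)\ge s_i\,\nu_{x_{-i}}(\cdot)\quad\text{for every }x_i\in\mathcal{X}_i.$$ Then AdapRSMwG is ergodic, i.e. $T(x_0,\alpha_0,n)\to0$ as $n\to\infty$. Moreover, if in addition (a') $\sup_{x_0,\alpha_0}|\alpha_n-\alpha_{n-1}|\to0$ in probability (supremum over all starting values $x_0\in\mathcal{X}$, $\alpha_0\in\mathcal{Y}$), then the convergence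 is uniform: $\sup_{x_0\in\mathcal{X},\,\alpha_0\in\mathcal{Y}}T(x_0,\alpha_0,n)\to0$ as $n\to\infty$.
   Context: Setting: $\mathcal{X}=\mathcal{X}_1\times\dots\times\mathcal{X}_d$ is a general product state space with countably generated $\sigma$-field $\mathcal{B}(\mathcal{X})$, $\pi$ is a probability measure on it. For $x\in\mathcal{X}$, $x_{-i}\in\mathcal{X}_{-i}$ denotes $x$ with the $i$-th coordinate removed, and $\pi(\cdot\,|\,x_{-i})$ is the conditional distribution of $Z_i$ given $Z_{-i}=x_{-i}$, $Z\sim\pi$ (a fixed regular version); the same symbol denotes its density with respect to a reference measure on $\mathcal{X}_i$. RSG($\alpha$): the Markov chain which from $x$ chooses a coordinate $i$ with probability $\alpha_i$, draws $Y\sim\pi(\cdot\,|\,x_{-i})$, and replaces the $i$-th coordinate of $x$ by $Y$. For each $i$ and $x_{-i}$, let $Q_{x_{-i}}(x_i,\cdot)$ be a fixed proposal kernel on $\mathcal{X}_i$ with density $q_{x_{-i}}(x_i,\cdot)$ (jointly measurable). $P_{x_{-i}}$ is the Metropolis(-Hastings) kernel on $\mathcal{X}_i$ with target $\pi(\cdot\,|\,x_{-i})$: from $x_i$, draw $Y\sim Q_{x_{-i}}(x_i,\cdot)$, move to $Y$ with probability $\min\left(1,\frac{\pi(Y|x_{-i})\,q_{x_{-i}}(Y,x_i)}{\pi(x_i|x_{-i})\,q_{x_{-i}}(x_i,Y)}\right)$, otherwise stay at $x_i$. AdapRSMwG: given $X_0=x_0$ and $\alpha_0$, for $n\ge 1$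 set $\alpha_n:=R_n(\alpha_{n-1},X_{n-1},\dots,X_0)\in\mathcal{Y}$ for some (measurable) update rule $R_n$; choose a coordinate $i$ with probabilities $\alpha_n$; replace the $i$-th coordinate $X_{n-1,i}$ by a draw from $P_{X_{n-1,-i}}(X_{n-1,i},\cdot)$, leaving the others unchanged, to obtain $X_n$. $\pi_n(x_0,\alpha_0)$ is the distribution of $X_n$ given $X_0=x_0$ and $\alpha_0$, and $T(x_0,\alpha_0,n):=\|\pi_n(x_0,\alpha_0)-\pi\|_{TV}$. A kernel $P$ with stationary distribution $\pi$ is uniformly ergodic if there are $M<\infty$, $\rho<1$ with $\|P^n(x,\cdot)-\pi\|_{TV}\le M\rho^n$ for all $x$ and $n$. $|\cdot|$ is the Euclidean norm on $\mathbb{R}^d$. In (a'), the processes for the different starting values are regarded as constructed on a common probability space. *)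

theory Defs
  imports "HOL-Probability.Probability"
begin

section \<open>Kernels on a general state space\<close>

definition countably_generated :: "'s measure \<Rightarrow> bool" where
  "countably_generated N \<longleftrightarrow>
     (\<exists>G. countable G \<and> G \<subseteq> Pow (space N) \<and> sets N = sigma_sets (space N) G)"

text \<open>Total variation distance, normalised to take values in \<open>[0,1]\<close> on probability measures.\<close>

definition tv_dist :: "'s measure \<Rightarrow> 's measure \<Rightarrow> 's measure \<Rightarrow> real" where
  "tv_dist N \<mu> \<nu> = (SUP A\<in>sets N. \<bar>measure \<mu> A - measure \<nu> A\<bar>)"

primrec kernel_pow :: "'s measure \<Rightarrow> ('s \<Rightarrow> 's measure) \<Rightarrow> nat \<Rightarrow> 's \<Rightarrow> 's measure" where
  "kernel_pow N P 0 x = return N x"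
| "kernel_pow N P (Suc n) x = kernel_pow N P n x \<bind> P"

definition uniformly_ergodic :: "'s measure \<Rightarrow> ('s \<Rightarrow> 's measure) \<Rightarrow> 's measure \<Rightarrow> bool" where
  "uniformly_ergodic N P \<pi> \<longleftrightarrow>
     \<pi> \<bind> P = \<pi> \<and>
     (\<exists>C \<rho>. 0 \<le> \<rho> \<and> \<rho> < 1 \<and>
        (\<forall>x\<in>space N. \<forall>n. tv_dist N (kernel_pow N P n x) \<pi> \<le> C * \<rho> ^ n))"

text \<open>
  \<open>K\<close> is a regular version of the conditional distribution of \<open>V\<close> (with values in \<open>F\<close>)
  given \<open>U\<close> (with values in \<open>E\<close>) under the probability measure \<open>\<Omega>\<close>.
\<close>

definition regular_cond_distr ::
    "'w measure \<Rightarrow> 'e measure \<Rightarrow> ('w \<Rightarrow> 'e) \<Rightarrow> 'f measure \<Rightarrow> ('w \<Rightarrow> 'f) \<Rightarrow> ('e \<Rightarrow> 'f measure) \<Rightarrow> bool" where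
  "regular_cond_distr \<Omega> E U F V K \<longleftrightarrow>
     K \<in> E \<rightarrow>\<^sub>M prob_algebra F \<and>
     (\<forall>B\<in>sets E. \<forall>A\<in>sets F.
        emeasure \<Omega> {w \<in> space \<Omega>. U w \<in> B \<and> V w \<in> A} =
        (\<integral>\<^sup>+ w. indicator B (U w) * emeasure (K (U w)) A \<partial>\<Omega>))"

text \<open>
  Convergence of \<open>Z\<^sub>n \<ge> 0\<close> to \<open>0\<close> in probability. The outer measure agrees with the probability
  on events; it is needed for suprema over uncountable families, which need not be measurable.
\<close>

definition tendsto_0_in_prob :: "'w measure \<Rightarrow> (nat \<Rightarrow> 'w \<Rightarrow> real) \<Rightarrow> bool" where
  "tendsto_0_in_prob \<Omega> Z \<longleftrightarrow>
     (\<forall>\<delta>>0. (\<lambda>n. outer_measure_of \<Omega> {w \<in> space \<Omega>. Z n w > \<delta>}) \<longlonglongrightarrow> 0)"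

section \<open>Product state space and conditional densities\<close>

text \<open>
  The coordinates are indexed by a finite type \<open>'d\<close>, and \<open>M i\<close> is the \<open>i\<close>-th coordinate space with
  its \<open>\<sigma>\<close>-field and its reference measure. Only the \<open>\<sigma>\<close>-fields of the product spaces below
  are ever used, not the product of the reference measures.
  The coordinate spaces may be arbitrary different subsets of the common type \<open>'a\<close>.
\<close>

abbreviation state_space :: "('d::finite \<Rightarrow> 'a measure) \<Rightarrow> ('d \<Rightarrow> 'a) measure" where
  "state_space M \<equiv> Pi\<^sub>M UNIV M"

text \<open>The space of the points \<open>x\<^sub>-\<^sub>i\<close>, and the map taking \<open>x\<close> to \<open>x\<^sub>-\<^sub>i\<close>.\<close>

abbreviation minus_space :: "('d::finite \<Rightarrow> 'a measure) \<Rightarrow> 'd \<Rightarrow> ('d \<Rightarrow> 'a) measure" where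
  "minus_space M i \<equiv> Pi\<^sub>M (- {i}) M"

definition minus_coord :: "'d \<Rightarrow> ('d \<Rightarrow> 'a) \<Rightarrow> ('d \<Rightarrow> 'a)" where
  "minus_coord i x = restrict x (- {i})"

text \<open>
  \<open>p i z\<close> is the density of \<open>\<pi>(\<cdot> | x\<^sub>-\<^sub>i = z)\<close>, and \<open>q i z x\<close> that of the proposal \<open>Q\<^sub>z(x, \<cdot>)\<close>.
  If the reference measures are \<open>\<sigma>\<close>-finite, measurability of the two kernels follows from the
  joint measurability of the densities; requiring it directly makes \<open>\<sigma>\<close>-finiteness unnecessary.
\<close>

definition cond_kernel ::
    "('d::finite \<Rightarrow> 'a measure) \<Rightarrow> ('d \<Rightarrow> ('d \<Rightarrow> 'a) \<Rightarrow> 'a \<Rightarrow> real) \<Rightarrow> 'd \<Rightarrow> ('d \<Rightarrow> 'a) \<Rightarrow> 'a measure" where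
  "cond_kernel M p i z = density (M i) (\<lambda>y. ennreal (p i z y))"

definition conditional_densities ::
    "('d::finite \<Rightarrow> 'a measure) \<Rightarrow> ('d \<Rightarrow> 'a) measure \<Rightarrow> ('d \<Rightarrow> ('d \<Rightarrow> 'a) \<Rightarrow> 'a \<Rightarrow> real) \<Rightarrow> bool" where
  "conditional_densities M \<pi> p \<longleftrightarrow>
     (\<forall>i. (\<lambda>(z, y). p i z y) \<in> borel_measurable (minus_space M i \<Otimes>\<^sub>M M i) \<and>
          (\<forall>z\<in>space (minus_space M i). \<forall>y\<in>space (M i). 0 \<le> p i z y) \<and>
          regular_cond_distr \<pi> (minus_space M i) (minus_coord i) (M i) (\<lambda>x. x i) (cond_kernel M p i))"

definition proposal_densities ::
    "('d::finite \<Rightarrow> 'a measure) \<Rightarrow> ('d \<Rightarrow> ('d \<Rightarrow> 'a) \<Rightarrow> 'a \<Rightarrow> 'a \<Rightarrow> real) \<Rightarrow> bool" where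
  "proposal_densities M q \<longleftrightarrow>
     (\<forall>i. (\<lambda>(z, x, y). q i z x y) \<in> borel_measurable (minus_space M i \<Otimes>\<^sub>M M i \<Otimes>\<^sub>M M i) \<and>
          (\<forall>z\<in>space (minus_space M i). \<forall>x\<in>space (M i). \<forall>y\<in>space (M i). 0 \<le> q i z x y) \<and>
          (\<lambda>(z, x). density (M i) (\<lambda>y. ennreal (q i z x y)))
            \<in> minus_space M i \<Otimes>\<^sub>M M i \<rightarrow>\<^sub>M prob_algebra (M i))"

section \<open>Metropolis-Hastings and random scan kernels\<close>

text \<open>
  \<open>f\<close> is the target density and \<open>g\<close> the proposal density. As usual, proposals are accepted when
  the denominator of the acceptance ratio vanishes.
\<close>

definition mh_accept :: "('a \<Rightarrow> real) \<Rightarrow> ('a \<Rightarrow> 'a \<Rightarrow> real) \<Rightarrow> 'a \<Rightarrow> 'a \<Rightarrow> real" where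
  "mh_accept f g x y =
     (if f x * g x y = 0 then 1 else min 1 ((f y * g y x) / (f x * g x y)))"

definition mh_kernel ::
    "'a measure \<Rightarrow> ('a \<Rightarrow> real) \<Rightarrow> ('a \<Rightarrow> 'a \<Rightarrow> real) \<Rightarrow> 'a \<Rightarrow> 'a measure" where
  "mh_kernel N f g x =
     density N (\<lambda>y. ennreal (g x y)) \<bind>
       (\<lambda>y. distr (measure_pmf (bernoulli_pmf (mh_accept f g x y))) N
               (\<lambda>accept. if accept then y else x))"

text \<open>The kernel \<open>P\<close> on \<open>M i\<close> associated with \<open>x\<^sub>-\<^sub>i = z\<close>.\<close>

definition metropolis_kernel ::
    "('d::finite \<Rightarrow> 'a measure) \<Rightarrow> ('d \<Rightarrow> ('d \<Rightarrow> 'a) \<Rightarrow> 'a \<Rightarrow> real)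
      \<Rightarrow> ('d \<Rightarrow> ('d \<Rightarrow> 'a) \<Rightarrow> 'a \<Rightarrow> 'a \<Rightarrow> real) \<Rightarrow> 'd \<Rightarrow> ('d \<Rightarrow> 'a) \<Rightarrow> 'a \<Rightarrow> 'a measure" where
  "metropolis_kernel M p q i z = mh_kernel (M i) (p i z) (q i z)"

text \<open>
  Draw a coordinate \<open>i\<close> with probability \<open>\<alpha>\<^sub>i\<close> and replace \<open>x\<^sub>i\<close> by a draw from \<open>\<kappa> i x\<^sub>-\<^sub>i x\<^sub>i\<close>.
  This is used for probability vectors \<open>\<alpha>\<close> only.
\<close>

definition random_scan_kernel ::
    "('d::finite \<Rightarrow> 'a measure) \<Rightarrow> ('d \<Rightarrow> ('d \<Rightarrow> 'a) \<Rightarrow> 'a \<Rightarrow> 'a measure)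
      \<Rightarrow> real ^ 'd \<Rightarrow> ('d \<Rightarrow> 'a) \<Rightarrow> ('d \<Rightarrow> 'a) measure" where
  "random_scan_kernel M \<kappa> \<alpha> x =
     measure_pmf (embed_pmf (\<lambda>i. \<alpha> $ i)) \<bind>
       (\<lambda>i. distr (\<kappa> i (minus_coord i x) (x i)) (state_space M) (\<lambda>y. x(i := y)))"

definition RSG ::
    "('d::finite \<Rightarrow> 'a measure) \<Rightarrow> ('d \<Rightarrow> ('d \<Rightarrow> 'a) \<Rightarrow> 'a \<Rightarrow> real)
      \<Rightarrow> real ^ 'd \<Rightarrow> ('d \<Rightarrow> 'a) \<Rightarrow> ('d \<Rightarrow> 'a) measure" where
  "RSG M p = random_scan_kernel M (\<lambda>i z x. cond_kernel M p i z)"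

definition RSMwG ::
    "('d::finite \<Rightarrow> 'a measure) \<Rightarrow> ('d \<Rightarrow> ('d \<Rightarrow> 'a) \<Rightarrow> 'a \<Rightarrow> real)
      \<Rightarrow> ('d \<Rightarrow> ('d \<Rightarrow> 'a) \<Rightarrow> 'a \<Rightarrow> 'a \<Rightarrow> real)
      \<Rightarrow> real ^ 'd \<Rightarrow> ('d \<Rightarrow> 'a) \<Rightarrow> ('d \<Rightarrow> 'a) measure" where
  "RSMwG M p q = random_scan_kernel M (metropolis_kernel M p q)"

section \<open>The adaptive sampler\<close>

definition prob_simplex :: "(real ^ 'd::finite) set" where
  "prob_simplex = {v. (\<forall>i. 0 \<le> v $ i) \<and> (\<Sum>i\<in>UNIV. v $ i) = 1}"

definition selection_set :: "real \<Rightarrow> (real ^ 'd::finite) set" where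
  "selection_set \<epsilon> = {v. \<forall>i. v $ i \<in> {\<epsilon>..1}} \<inter> prob_simplex"

text \<open>The history \<open>X\<^sub>0, \<dots>, X\<^sub>n\<close> is an element of the product of \<open>n + 1\<close> copies of the state space.\<close>

abbreviation history_space :: "('d::finite \<Rightarrow> 'a measure) \<Rightarrow> nat \<Rightarrow> (nat \<Rightarrow> 'd \<Rightarrow> 'a) measure" where
  "history_space M n \<equiv> Pi\<^sub>M {..n} (\<lambda>_. state_space M)"

definition update_rule ::
    "('d::finite \<Rightarrow> 'a measure) \<Rightarrow> (real ^ 'd) set
      \<Rightarrow> (nat \<Rightarrow> real ^ 'd \<Rightarrow> (nat \<Rightarrow> 'd \<Rightarrow> 'a) \<Rightarrow> real ^ 'd) \<Rightarrow> bool" where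
  "update_rule M Y R \<longleftrightarrow>
     (\<forall>n. (\<lambda>(\<alpha>, h). R (Suc n) \<alpha> h)
        \<in> restrict_space borel Y \<Otimes>\<^sub>M history_space M n \<rightarrow>\<^sub>M restrict_space borel Y)"

text \<open>The weights \<open>\<alpha>\<^sub>n\<close> obtained from the initial value \<open>\<alpha>0\<close> along the trajectory \<open>h\<close>.\<close>

primrec adaptive_weights ::
    "(nat \<Rightarrow> real ^ 'd::finite \<Rightarrow> (nat \<Rightarrow> 'd \<Rightarrow> 'a) \<Rightarrow> real ^ 'd)
      \<Rightarrow> real ^ 'd \<Rightarrow> nat \<Rightarrow> (nat \<Rightarrow> 'd \<Rightarrow> 'a) \<Rightarrow> real ^ 'd" where
  "adaptive_weights R \<alpha>0 0 h = \<alpha>0"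
| "adaptive_weights R \<alpha>0 (Suc n) h = R (Suc n) (adaptive_weights R \<alpha>0 n h) (restrict h {..n})"

text \<open>
  \<open>X\<close> is a run of the sampler on \<open>\<Omega>\<close> started at \<open>x0\<close>, \<open>\<alpha>0\<close>, characterised by the conditional law of each
  state given the preceding ones; the choice of the coordinate is integrated out in the kernel.
\<close>

definition AdapRSMwG ::
    "('d::finite \<Rightarrow> 'a measure) \<Rightarrow> ('d \<Rightarrow> ('d \<Rightarrow> 'a) \<Rightarrow> 'a \<Rightarrow> real)
      \<Rightarrow> ('d \<Rightarrow> ('d \<Rightarrow> 'a) \<Rightarrow> 'a \<Rightarrow> 'a \<Rightarrow> real)
      \<Rightarrow> (nat \<Rightarrow> real ^ 'd \<Rightarrow> (nat \<Rightarrow> 'd \<Rightarrow> 'a) \<Rightarrow> real ^ 'd)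
      \<Rightarrow> ('d \<Rightarrow> 'a) \<Rightarrow> real ^ 'd \<Rightarrow> 'w measure \<Rightarrow> (nat \<Rightarrow> 'w \<Rightarrow> 'd \<Rightarrow> 'a) \<Rightarrow> bool" where
  "AdapRSMwG M p q R x0 \<alpha>0 \<Omega> X \<longleftrightarrow>
     (\<forall>n. X n \<in> \<Omega> \<rightarrow>\<^sub>M state_space M) \<and>
     (\<forall>w\<in>space \<Omega>. X 0 w = x0) \<and>
     (\<forall>n. regular_cond_distr \<Omega>
            (history_space M n) (\<lambda>w. \<lambda>k\<in>{..n}. X k w)
            (state_space M) (X (Suc n))
            (\<lambda>h. RSMwG M p q (adaptive_weights R \<alpha>0 (Suc n) h) (h n)))"

text \<open>\<open>|\<alpha>\<^sub>n\<^sub>+\<^sub>1 - \<alpha>\<^sub>n|\<close> as a random variable; \<open>norm\<close> is the Euclidean norm on \<open>real ^ 'd\<close>.\<close>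

definition weight_change ::
    "(nat \<Rightarrow> real ^ 'd::finite \<Rightarrow> (nat \<Rightarrow> 'd \<Rightarrow> 'a) \<Rightarrow> real ^ 'd)
      \<Rightarrow> real ^ 'd \<Rightarrow> (nat \<Rightarrow> 'w \<Rightarrow> 'd \<Rightarrow> 'a) \<Rightarrow> nat \<Rightarrow> 'w \<Rightarrow> real" where
  "weight_change R \<alpha>0 X n w =
     norm (adaptive_weights R \<alpha>0 (Suc n) (\<lambda>k. X k w) - adaptive_weights R \<alpha>0 n (\<lambda>k. X k w))"

end

theory Submission
  imports Defs
begin

text \<open>
  Everything is phrased through Markov operators on bounded measurable functions. By the uniform
  minorization, \<open>k\<close> consecutive Metropolis updates of one coordinate are uniformly close to a Gibbs
  update of it, so the \<open>n\<close>-th power of the mixture (with weights \<open>\<beta>\<close>) of these \<open>k\<close>-fold updates is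
  close to the \<open>n\<close>-th power of RSG(\<open>\<beta>\<close>), hence to \<open>\<pi>\<close>. For every \<open>\<alpha>\<close> with entries at least \<open>\<epsilon>\<close>, a
  block of \<open>k n\<close> steps of the Metropolis-within-Gibbs scan dominates \<open>\<epsilon>\<^sup>k\<^sup>n\<close> times that power, and
  is therefore a contraction with a factor not depending on \<open>\<alpha>\<close>.
  For the adaptive chain, freeze the weights \<open>N\<close> steps before the time of interest: the frozen chain
  is close to \<open>\<pi>\<close> uniformly in the past, and replacing it by the adaptive one costs at most the
  expected drift of the weights over \<open>N\<close> steps, which vanishes by diminishing adaptation.
\<close>

section \<open>Markov operators on bounded measurable functions\<close>

text \<open>Total variation as normalised in \<open>tv_dist\<close> is tested by functions with
  values in [0,1]: a bound \<open>c\<close> on all events carries over to them with the same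
  constant.\<close>

definition unit_fun :: "'s measure \<Rightarrow> ('s \<Rightarrow> real) set" where
  "unit_fun N = {f \<in> borel_measurable N. \<forall>x\<in>space N. 0 \<le> f x \<and> f x \<le> 1}"

definition bounded_fun :: "'s measure \<Rightarrow> ('s \<Rightarrow> real) set" where
  "bounded_fun N = {f \<in> borel_measurable N. \<exists>b. \<forall>x\<in>space N. \<bar>f x\<bar> \<le> b}"

lemma bounded_funI:
  assumes "f \<in> borel_measurable N" "\<And>x. x \<in> space N \<Longrightarrow> \<bar>f x\<bar> \<le> b"
  shows "f \<in> bounded_fun N"
  using assms by (auto simp: bounded_fun_def)

lemma unit_fun_bounded: "f \<in> unit_fun N \<Longrightarrow> f \<in> bounded_fun N"
  by (rule bounded_funI[of _ _ 1]) (auto simp: unit_fun_def)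

lemma indicator_unit_fun: "A \<in> sets N \<Longrightarrow> indicator A \<in> unit_fun N"
  by (auto simp: unit_fun_def indicator_def)

lemma const_bounded_fun [simp]: "(\<lambda>_. c) \<in> bounded_fun N"
  by (auto simp: bounded_fun_def)

lemma lincomb_bounded_fun:
  assumes "f \<in> bounded_fun N" "g \<in> bounded_fun N"
  shows "(\<lambda>x. a * f x + b * g x) \<in> bounded_fun N"
proof -
  obtain u v where u: "\<forall>x\<in>space N. \<bar>f x\<bar> \<le> u" and v: "\<forall>x\<in>space N. \<bar>g x\<bar> \<le> v"
    using assms unfolding bounded_fun_def by blast
  show ?thesis
  proof (rule bounded_funI[of _ _ "\<bar>a\<bar> * u + \<bar>b\<bar> * v"])
    show "(\<lambda>x. a * f x + b * g x) \<in> borel_measurable N"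
      using assms by (auto simp: bounded_fun_def)
    fix x assume "x \<in> space N"
    then have "\<bar>a * f x\<bar> \<le> \<bar>a\<bar> * u" "\<bar>b * g x\<bar> \<le> \<bar>b\<bar> * v"
      using u v by (auto simp: abs_mult intro!: mult_left_mono)
    then show "\<bar>a * f x + b * g x\<bar> \<le> \<bar>a\<bar> * u + \<bar>b\<bar> * v" by linarith
  qed
qed

lemma diff_bounded_fun:
  assumes "f \<in> bounded_fun N" "g \<in> bounded_fun N"
  shows "(\<lambda>x. f x - g x) \<in> bounded_fun N"
  using lincomb_bounded_fun[OF assms, of 1 "-1"] by simp

lemma sum_bounded_fun:
  assumes "\<And>i. i \<in> I \<Longrightarrow> f i \<in> bounded_fun N"
  shows "(\<lambda>x. \<Sum>i\<in>I. a i * f i x) \<in> bounded_fun N"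
  using assms
proof (induction I rule: infinite_finite_induct)
  case (insert i I)
  then have "(\<lambda>x. a i * f i x + 1 * (\<Sum>i\<in>I. a i * f i x)) \<in> bounded_fun N"
    by (intro lincomb_bounded_fun) auto
  then show ?case using insert by simp
qed auto

lemma bounded_fun_integrable:
  assumes "prob_space \<mu>" "sets \<mu> = sets N" "f \<in> bounded_fun N"
  shows "integrable \<mu> f"
proof -
  interpret prob_space \<mu> by fact
  from assms obtain b where "f \<in> borel_measurable N" "\<forall>x\<in>space N. \<bar>f x\<bar> \<le> b"
    by (auto simp: bounded_fun_def)
  with assms(2) sets_eq_imp_space_eq[OF assms(2)] show ?thesis
    by (intro integrable_const_bound[where B=b] AE_I2) (auto cong: measurable_cong_sets)
qed

lemma bounded_fun_integral_bounds:
  assumes "prob_space \<mu>" "sets \<mu> = sets N" "f \<in> bounded_fun N"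
    and "\<And>x. x \<in> space N \<Longrightarrow> a \<le> f x" "\<And>x. x \<in> space N \<Longrightarrow> f x \<le> b"
  shows "a \<le> (\<integral>x. f x \<partial>\<mu>)" "(\<integral>x. f x \<partial>\<mu>) \<le> b"
proof -
  interpret prob_space \<mu> by fact
  have i: "integrable \<mu> f" using assms by (intro bounded_fun_integrable)
  have sp: "space \<mu> = space N" using assms by (simp cong: sets_eq_imp_space_eq)
  show "a \<le> (\<integral>x. f x \<partial>\<mu>)" using assms(4) sp i by (intro integral_ge_const AE_I2) auto
  show "(\<integral>x. f x \<partial>\<mu>) \<le> b" using assms(5) sp i by (intro integral_le_const AE_I2) auto
qed

text \<open>The proof approximates \<open>f\<close> by \<open>\<lfloor>n f\<rfloor> / n\<close>, which is the average of the indicators of \<open>{j \<le> n f}\<close>, \<open>1 \<le> j \<le> n\<close>.\<close>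

lemma integral_diff_le_of_measure_diff_le:
  assumes \<mu>: "prob_space \<mu>" "sets \<mu> = sets N" and \<nu>: "prob_space \<nu>" "sets \<nu> = sets N"
    and c: "\<And>A. A \<in> sets N \<Longrightarrow> \<bar>measure \<mu> A - measure \<nu> A\<bar> \<le> c"
    and f: "f \<in> unit_fun N"
  shows "\<bar>(\<integral>x. f x \<partial>\<mu>) - (\<integral>x. f x \<partial>\<nu>)\<bar> \<le> c"
proof -
  have fm[measurable]: "f \<in> borel_measurable N" using f by (auto simp: unit_fun_def)
  have bound: "\<bar>(\<integral>x. f x \<partial>\<mu>) - (\<integral>x. f x \<partial>\<nu>)\<bar> \<le> c + 2 / real n" if n: "n > 0" for n :: nat
  proof -
    define A where "A j = {x \<in> space N. real j \<le> real n * f x}" for j :: nat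
    have A[measurable]: "A j \<in> sets N" for j by (auto simp: A_def)
    define g where "g x = (\<Sum>j\<in>{1..n}. (1 / real n) * indicator (A j) x)" for x
    have approx: "\<bar>f x - g x\<bar> \<le> 1 / real n" if x: "x \<in> space N" for x
    proof -
      have f01: "0 \<le> f x" "f x \<le> 1" using f x by (auto simp: unit_fun_def)
      define k where "k = nat \<lfloor>real n * f x\<rfloor>"
      have k: "real k \<le> real n * f x" "real n * f x < real k + 1"
        using f01 by (auto simp: k_def)
      have "real n * f x \<le> real n * 1" using f01 by (intro mult_left_mono) auto
      then have kn: "k \<le> n" using k by linarith
      have "x \<in> A j \<longleftrightarrow> j \<le> k" for j
      proof -
        have "real j \<le> real n * f x \<longleftrightarrow> real j < real k + 1"
          using k by (smt (verit) of_nat_less_iff of_nat_Suc of_nat_le_iff less_Suc_eq_le)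
        also have "\<dots> \<longleftrightarrow> j \<le> k" by linarith
        finally show ?thesis using x by (simp only: A_def mem_Collect_eq simp_thms)
      qed
      then have "{1..n} \<inter> {j. x \<in> A j} = {1..n} \<inter> {..k}" by blast
      also have "\<dots> = {1..k}" using kn by auto
      finally have "{1..n} \<inter> {j. x \<in> A j} = {1..k}" .
      then have "(\<Sum>j\<in>{1..n}. indicator (A j) x :: real) = real k"
        by (simp add: indicator_def sum.If_cases)
      then have g: "g x = real k / real n"
        unfolding g_def by (simp add: sum_divide_distrib[symmetric])
      have "f x - g x = (real n * f x - real k) / real n" using n g by (simp add: field_simps)
      moreover have "\<bar>(real n * f x - real k) / real n\<bar> \<le> 1 / real n"
      proof -
        have "0 \<le> (real n * f x - real k) / real n" using k by simp
        moreover have "(real n * f x - real k) / real n \<le> 1 / real n" using k by (intro divide_right_mono) auto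
        ultimately show ?thesis by simp
      qed
      ultimately show ?thesis by simp
    qed
    have gb: "g \<in> bounded_fun N"
      unfolding g_def by (intro sum_bounded_fun unit_fun_bounded indicator_unit_fun A)
    have fb: "f \<in> bounded_fun N" using f by (rule unit_fun_bounded)
    have near: "\<bar>(\<integral>x. f x \<partial>\<kappa>) - (\<integral>x. g x \<partial>\<kappa>)\<bar> \<le> 1 / real n"
      and gint: "(\<integral>x. g x \<partial>\<kappa>) = (\<Sum>j\<in>{1..n}. (1 / real n) * measure \<kappa> (A j))"
      if \<kappa>: "prob_space \<kappa>" "sets \<kappa> = sets N" for \<kappa>
    proof -
      interpret prob_space \<kappa> by fact
      have "(\<integral>x. f x \<partial>\<kappa>) - (\<integral>x. g x \<partial>\<kappa>) = (\<integral>x. f x - g x \<partial>\<kappa>)"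
        using bounded_fun_integrable[OF \<kappa> fb] bounded_fun_integrable[OF \<kappa> gb] by simp
      moreover have *: "-(1/real n) \<le> f x - g x" "f x - g x \<le> 1/real n" if "x \<in> space N" for x
        using approx[OF that] by (simp_all add: abs_le_iff)
      note bounded_fun_integral_bounds[OF \<kappa> diff_bounded_fun[OF fb gb] *]
      ultimately show "\<bar>(\<integral>x. f x \<partial>\<kappa>) - (\<integral>x. g x \<partial>\<kappa>)\<bar> \<le> 1 / real n" by linarith
      have A\<kappa>: "A j \<in> sets \<kappa>" for j using \<kappa> A by simp
      have "integrable \<kappa> (\<lambda>x. (1 / real n) * indicator (A j) x :: real)" for j
        using A\<kappa> by (auto simp: integrable_indicator_iff emeasure_eq_measure)
      then have "(\<integral>x. g x \<partial>\<kappa>) = (\<Sum>j\<in>{1..n}. (\<integral>x. (1 / real n) * indicator (A j) x \<partial>\<kappa>))"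
        unfolding g_def by (rule Bochner_Integration.integral_sum)
      then show "(\<integral>x. g x \<partial>\<kappa>) = (\<Sum>j\<in>{1..n}. (1 / real n) * measure \<kappa> (A j))"
        using A\<kappa> sets.sets_into_space[OF A\<kappa>] by (simp add: Int_absorb2)
    qed
    have "\<bar>(\<integral>x. g x \<partial>\<mu>) - (\<integral>x. g x \<partial>\<nu>)\<bar>
        = \<bar>\<Sum>j\<in>{1..n}. (1 / real n) * (measure \<mu> (A j) - measure \<nu> (A j))\<bar>"
      by (simp add: gint \<mu> \<nu> sum_subtractf[symmetric] right_diff_distrib diff_divide_distrib)
    also have "\<dots> \<le> (\<Sum>j\<in>{1..n}. \<bar>(1 / real n) * (measure \<mu> (A j) - measure \<nu> (A j))\<bar>)"
      by (rule sum_abs)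
    also have "\<dots> \<le> (\<Sum>j\<in>{1..n}. (1 / real n) * c)"
    proof (rule sum_mono)
      fix j
      have "(1 / real n) * \<bar>measure \<mu> (A j) - measure \<nu> (A j)\<bar> \<le> (1 / real n) * c"
        by (intro mult_left_mono c) auto
      then show "\<bar>(1 / real n) * (measure \<mu> (A j) - measure \<nu> (A j))\<bar> \<le> (1 / real n) * c"
        by (simp add: abs_mult)
    qed
    also have "\<dots> = c" using n by simp
    finally show ?thesis using near[OF \<mu>] near[OF \<nu>] by linarith
  qed
  have "(\<lambda>n. c + 2 / real n) \<longlonglongrightarrow> c + 0"
    by (intro tendsto_intros lim_const_over_n)
  then show ?thesis
    by (intro LIMSEQ_le_const[where X="\<lambda>n. c + 2 / real n"]) (auto intro!: exI[of _ 1] bound)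
qed

text \<open>An axiomatic form shared by integration against a kernel, updates of one coordinate, and
  their mixtures and powers. Equations are required at points of \<open>space N\<close> only, since
  nothing is known about a bounded measurable function elsewhere.\<close>

locale markov_op =
  fixes N :: "'s measure" and T :: "('s \<Rightarrow> real) \<Rightarrow> 's \<Rightarrow> real"
  assumes closed: "f \<in> bounded_fun N \<Longrightarrow> T f \<in> bounded_fun N"
    and lincomb: "f \<in> bounded_fun N \<Longrightarrow> g \<in> bounded_fun N \<Longrightarrow> x \<in> space N \<Longrightarrow>
      T (\<lambda>y. a * f y + b * g y) x = a * T f x + b * T g x"
    and one: "x \<in> space N \<Longrightarrow> T (\<lambda>_. 1) x = 1"
    and pos: "f \<in> bounded_fun N \<Longrightarrow> (\<And>y. y \<in> space N \<Longrightarrow> 0 \<le> f y) \<Longrightarrow> x \<in> space N \<Longrightarrow> 0 \<le> T f x"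
begin

lemma affine:
  assumes "f \<in> bounded_fun N" "x \<in> space N"
  shows "T (\<lambda>y. a * f y + b) x = a * T f x + b"
  using lincomb[OF assms(1) const_bounded_fun[of 1] assms(2), of a b] one[OF assms(2)] by simp

lemma mono:
  assumes "f \<in> bounded_fun N" "g \<in> bounded_fun N" "\<And>y. y \<in> space N \<Longrightarrow> f y \<le> g y" "x \<in> space N"
  shows "T f x \<le> T g x"
proof -
  have "0 \<le> T (\<lambda>y. 1 * g y + (-1) * f y) x"
    using assms by (intro pos lincomb_bounded_fun) auto
  then show ?thesis using lincomb[OF assms(2,1,4), of 1 "-1"] by simp
qed

lemma cong:
  assumes "f \<in> bounded_fun N" "g \<in> bounded_fun N" "\<And>y. y \<in> space N \<Longrightarrow> f y = g y" "x \<in> space N"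
  shows "T f x = T g x"
  using assms by (intro antisym mono) auto

lemma const: "x \<in> space N \<Longrightarrow> T (\<lambda>_. c) x = c"
  using affine[OF const_bounded_fun[of 0], of x 0 c] by simp

lemma lower:
  assumes "f \<in> bounded_fun N" "\<And>y. y \<in> space N \<Longrightarrow> a \<le> f y" "x \<in> space N"
  shows "a \<le> T f x"
  using mono[of "\<lambda>_. a" f x] assms by (simp add: const)

lemma upper:
  assumes "f \<in> bounded_fun N" "\<And>y. y \<in> space N \<Longrightarrow> f y \<le> a" "x \<in> space N"
  shows "T f x \<le> a"
  using mono[of f "\<lambda>_. a" x] assms by (simp add: const)

lemma unit: "f \<in> unit_fun N \<Longrightarrow> T f \<in> unit_fun N"
  using closed[of f] lower[of f 0] upper[of f 1] unit_fun_bounded[of f N]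
  by (auto simp: unit_fun_def bounded_fun_def)

lemma nonexpansive:
  assumes "f \<in> bounded_fun N" "g \<in> bounded_fun N" "\<And>y. y \<in> space N \<Longrightarrow> \<bar>f y - g y\<bar> \<le> c" "x \<in> space N"
  shows "\<bar>T f x - T g x\<bar> \<le> c"
proof -
  have *: "- c \<le> f y - g y" "f y - g y \<le> c" if "y \<in> space N" for y
    using assms(3)[OF that] by auto
  have "- c \<le> T (\<lambda>y. f y - g y) x" "T (\<lambda>y. f y - g y) x \<le> c"
    using assms * by (auto intro!: lower upper diff_bounded_fun)
  then show ?thesis using lincomb[OF assms(1,2,4), of 1 "-1"] by simp
qed

lemma power: "markov_op N (T ^^ n)"
proof (induction n)
  case 0
  show ?case by unfold_locales auto
next
  case (Suc n)
  interpret n: markov_op N "T ^^ n" by fact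
  show ?case
  proof
    fix f g x a b assume f: "f \<in> bounded_fun N" and g: "g \<in> bounded_fun N" and x: "x \<in> space N"
    \<comment> \<open>Linearity of the inner power holds only on \<open>space N\<close>, so it is
      rewritten under \<open>T\<close> through \<open>cong\<close>.\<close>
    have "T ((T ^^ n) (\<lambda>y. a * f y + b * g y)) x = T (\<lambda>y. a * (T ^^ n) f y + b * (T ^^ n) g y) x"
      by (intro cong lincomb_bounded_fun n.closed f g n.lincomb x)
    then show "(T ^^ Suc n) (\<lambda>y. a * f y + b * g y) x = a * (T ^^ Suc n) f x + b * (T ^^ Suc n) g x"
      by (simp add: lincomb n.closed f g x)
  next
    fix x assume x: "x \<in> space N"
    have "T ((T ^^ n) (\<lambda>_. 1)) x = T (\<lambda>_. 1) x"
      by (intro cong n.closed) (auto simp: n.one x)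
    then show "(T ^^ Suc n) (\<lambda>_. 1) x = 1" using x by (simp add: one)
  qed (auto intro!: closed n.closed pos n.pos)
qed

text \<open>
  A contraction estimate for functions with values in \<open>[0,1]\<close> iterates, since a function of
  oscillation \<open>w\<close> becomes one with values in \<open>[0,1]\<close> after subtracting its infimum and dividing by \<open>w\<close>.
\<close>

lemma contraction_power:
  assumes r: "0 < r"
    and contr: "\<And>f x y. f \<in> unit_fun N \<Longrightarrow> x \<in> space N \<Longrightarrow> y \<in> space N \<Longrightarrow> \<bar>(T ^^ m) f x - (T ^^ m) f y\<bar> \<le> r"
    and f: "f \<in> unit_fun N"
  shows "x \<in> space N \<Longrightarrow> y \<in> space N \<Longrightarrow> \<bar>(T ^^ (m * j)) f x - (T ^^ (m * j)) f y\<bar> \<le> r ^ j"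
proof (induction j arbitrary: x y)
  case 0
  then have "0 \<le> f x" "f x \<le> 1" "0 \<le> f y" "f y \<le> 1" using f by (auto simp: unit_fun_def)
  then show ?case by simp
next
  case (Suc j)
  define g where "g = (T ^^ (m * j)) f"
  interpret Tj: markov_op N "T ^^ (m * j)" by (rule power)
  interpret Tm: markov_op N "T ^^ m" by (rule power)
  have g: "g \<in> bounded_fun N" unfolding g_def by (intro Tj.closed unit_fun_bounded f)
  then obtain b where b: "\<forall>x\<in>space N. \<bar>g x\<bar> \<le> b" by (auto simp: bounded_fun_def)
  define a where "a = Inf (g ` space N)"
  have bdd: "bdd_below (g ` space N)" using b by (intro bdd_belowI2[of _ "-b"]) (auto simp: abs_le_iff)
  have low: "a \<le> g z" if "z \<in> space N" for z unfolding a_def using that bdd by (intro cInf_lower) auto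
  have up: "g z \<le> a + r ^ j" if z: "z \<in> space N" for z
  proof -
    have "g z - r ^ j \<le> a" unfolding a_def
    proof (rule cINF_greatest)
      show "space N \<noteq> {}" using z by auto
      fix u assume u: "u \<in> space N"
      show "g z - r ^ j \<le> g u" using Suc.IH[OF z u] by (auto simp: g_def abs_le_iff)
    qed
    then show ?thesis by simp
  qed
  define h where "h = (\<lambda>z. (1 / r ^ j) * g z + (- a / r ^ j))"
  have rj: "0 < r ^ j" using r by simp
  have h_eq: "h z = (g z - a) / r ^ j" for z by (simp add: h_def diff_divide_distrib)
  have "h \<in> borel_measurable N" using g by (auto simp: h_def bounded_fun_def)
  then have h: "h \<in> unit_fun N"
    using g low up rj by (auto simp: unit_fun_def h_eq bounded_fun_def divide_le_eq algebra_simps)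
  have "(T ^^ m) g z = r ^ j * (T ^^ m) h z + a" if z: "z \<in> space N" for z
  proof -
    have "w * ((1 / w) * t + (- a / w)) + a = t" if "0 < w" for w t :: real
      using that by (simp add: field_simps)
    from this[OF rj] show ?thesis unfolding h_def by (simp only: Tm.affine[OF g z])
  qed
  then have "\<bar>(T ^^ m) g x - (T ^^ m) g y\<bar> = r ^ j * \<bar>(T ^^ m) h x - (T ^^ m) h y\<bar>"
    using Suc.prems rj by (simp add: abs_mult right_diff_distrib[symmetric])
  also have "\<dots> \<le> r ^ j * r" using rj by (intro mult_left_mono contr h Suc.prems) auto
  finally have "\<bar>(T ^^ m) g x - (T ^^ m) g y\<bar> \<le> r ^ Suc j" by (simp add: mult.commute)
  moreover have "(T ^^ m) g = (T ^^ (m * Suc j)) f"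
    by (simp add: g_def funpow_add)
  ultimately show ?case by simp
qed

lemma integral_power:
  assumes "prob_space \<mu>" "sets \<mu> = sets N"
    and inv: "\<And>f. f \<in> bounded_fun N \<Longrightarrow> (\<integral>x. T f x \<partial>\<mu>) = (\<integral>x. f x \<partial>\<mu>)" and f: "f \<in> bounded_fun N"
  shows "(\<integral>x. (T ^^ n) f x \<partial>\<mu>) = (\<integral>x. f x \<partial>\<mu>)"
proof (induction n)
  case (Suc n)
  interpret n: markov_op N "T ^^ n" by (rule power)
  show ?case using Suc inv[OF n.closed[OF f]] by simp
qed auto

text \<open>After \<open>m * j\<close> steps the function oscillates by at most
  \<open>r ^ j\<close>, so it lies within \<open>r ^ j\<close> of its mean under \<mu>, which
  invariance identifies with the mean of \<open>f\<close>. Further steps only average, so the bound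
  persists for every larger \<open>k\<close>; this freedom lets one exponent serve several
  operators.\<close>

lemma power_near_stationary:
  assumes r: "0 < r"
    and contr: "\<And>f x y. f \<in> unit_fun N \<Longrightarrow> x \<in> space N \<Longrightarrow> y \<in> space N \<Longrightarrow> \<bar>(T ^^ m) f x - (T ^^ m) f y\<bar> \<le> r"
    and \<mu>: "prob_space \<mu>" "sets \<mu> = sets N"
    and inv: "\<And>f. f \<in> bounded_fun N \<Longrightarrow> (\<integral>x. T f x \<partial>\<mu>) = (\<integral>x. f x \<partial>\<mu>)"
    and f: "f \<in> unit_fun N" and x: "x \<in> space N" and k: "m * j \<le> k"
  shows "\<bar>(T ^^ k) f x - (\<integral>x. f x \<partial>\<mu>)\<bar> \<le> r ^ j"
proof -
  interpret l: markov_op N "T ^^ (k - m * j)" by (rule power)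
  interpret Tj: markov_op N "T ^^ (m * j)" by (rule power)
  define g where "g = (T ^^ (m * j)) f"
  have g: "g \<in> bounded_fun N" unfolding g_def by (intro Tj.closed unit_fun_bounded f)
  have near: "\<bar>g y - (\<integral>x. f x \<partial>\<mu>)\<bar> \<le> r ^ j" if y: "y \<in> space N" for y
  proof -
    have *: "g y - r ^ j \<le> g z" "g z \<le> g y + r ^ j" if z: "z \<in> space N" for z
      using contraction_power[OF r contr f y z, of j] by (auto simp: g_def abs_le_iff)
    have "g y - r ^ j \<le> (\<integral>x. g x \<partial>\<mu>)" "(\<integral>x. g x \<partial>\<mu>) \<le> g y + r ^ j"
      using bounded_fun_integral_bounds[OF \<mu> g *] by auto
    moreover have "(\<integral>x. g x \<partial>\<mu>) = (\<integral>x. f x \<partial>\<mu>)"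
  unfolding g_def using \<mu> inv unit_fun_bounded[OF f] by (rule integral_power)
    ultimately show ?thesis by linarith
  qed
  have "(T ^^ k) f x = (T ^^ (k - m * j)) g x"
    using k by (simp add: g_def funpow_add[symmetric, THEN fun_cong, unfolded o_def])
  moreover have "\<bar>(T ^^ (k - m * j)) g x - (T ^^ (k - m * j)) (\<lambda>_. \<integral>x. f x \<partial>\<mu>) x\<bar> \<le> r ^ j"
    by (intro l.nonexpansive g near x) auto
  ultimately show ?thesis using x by (simp add: l.const)
qed

end

section \<open>Mixtures of Markov operators\<close>

definition mix :: "real ^ 'd::finite \<Rightarrow> ('d \<Rightarrow> ('s \<Rightarrow> real) \<Rightarrow> 's \<Rightarrow> real) \<Rightarrow> ('s \<Rightarrow> real) \<Rightarrow> 's \<Rightarrow> real" where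
  "mix \<alpha> T f x = (\<Sum>i\<in>UNIV. \<alpha> $ i * T i f x)"

lemma mix_markov_op:
  assumes "\<And>i. markov_op N (T i)" "\<alpha> \<in> prob_simplex"
  shows "markov_op N (mix \<alpha> T)"
proof
  interpret markov_op N "T i" for i by fact
  have \<alpha>: "\<And>i. 0 \<le> \<alpha> $ i" "(\<Sum>i\<in>UNIV. \<alpha> $ i) = 1" using assms by (auto simp: prob_simplex_def)
  show "mix \<alpha> T f \<in> bounded_fun N" if "f \<in> bounded_fun N" for f
    using sum_bounded_fun[of UNIV "\<lambda>i. T i f" N "\<lambda>i. \<alpha> $ i"] closed[OF that]
    by (simp add: mix_def[abs_def])
  show "mix \<alpha> T (\<lambda>y. a * f y + b * g y) x = a * mix \<alpha> T f x + b * mix \<alpha> T g x"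
    if "f \<in> bounded_fun N" "g \<in> bounded_fun N" "x \<in> space N" for f g x a b
    by (simp add: mix_def lincomb[OF that] sum.distrib sum_distrib_left algebra_simps)
  show "mix \<alpha> T (\<lambda>_. 1) x = 1" if "x \<in> space N" for x
    using that \<alpha> by (simp add: mix_def one)
  show "0 \<le> mix \<alpha> T f x" if "f \<in> bounded_fun N" "\<And>y. y \<in> space N \<Longrightarrow> 0 \<le> f y" "x \<in> space N" for f x
    unfolding mix_def using that \<alpha> by (intro sum_nonneg mult_nonneg_nonneg pos) auto
qed

lemma mix_diff_le:
  assumes "\<beta> \<in> prob_simplex" "\<And>i. \<bar>T i f x - G i f x\<bar> \<le> c"
  shows "\<bar>mix \<beta> T f x - mix \<beta> G f x\<bar> \<le> c"
proof -
  have \<beta>: "\<And>i. 0 \<le> \<beta> $ i" "(\<Sum>i\<in>UNIV. \<beta> $ i) = 1" using assms by (auto simp: prob_simplex_def)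
  have "\<bar>mix \<beta> T f x - mix \<beta> G f x\<bar> = \<bar>\<Sum>i\<in>UNIV. \<beta> $ i * (T i f x - G i f x)\<bar>"
    by (simp add: mix_def sum_subtractf[symmetric] right_diff_distrib)
  also have "\<dots> \<le> (\<Sum>i\<in>UNIV. \<bar>\<beta> $ i * (T i f x - G i f x)\<bar>)" by (rule sum_abs)
  also have "\<dots> \<le> (\<Sum>i\<in>UNIV. \<beta> $ i * c)"
    using \<beta> assms(2) by (intro sum_mono) (auto simp: abs_mult intro!: mult_left_mono)
  also have "\<dots> = c" using \<beta> by (simp add: sum_distrib_right[symmetric])
  finally show ?thesis .
qed

text \<open>A step is linear in the weights, so taking one step with the wrong weights costs at most
  their l1 distance, whatever the state.\<close>

lemma mix_weights_diff_le:
  assumes "\<And>i. \<bar>T i f x\<bar> \<le> 1"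
  shows "\<bar>mix \<alpha> T f x - mix \<beta> T f x\<bar> \<le> (\<Sum>i\<in>UNIV. \<bar>\<alpha> $ i - \<beta> $ i\<bar>)"
proof -
  have "\<bar>mix \<alpha> T f x - mix \<beta> T f x\<bar> = \<bar>\<Sum>i\<in>UNIV. (\<alpha> $ i - \<beta> $ i) * T i f x\<bar>"
    by (simp add: mix_def sum_subtractf[symmetric] left_diff_distrib)
  also have "\<dots> \<le> (\<Sum>i\<in>UNIV. \<bar>(\<alpha> $ i - \<beta> $ i) * T i f x\<bar>)" by (rule sum_abs)
  also have "\<dots> \<le> (\<Sum>i\<in>UNIV. \<bar>\<alpha> $ i - \<beta> $ i\<bar>)"
    using assms by (intro sum_mono) (auto simp: abs_mult intro!: mult_left_le)
  finally show ?thesis .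
qed

text \<open>
  With positive probability the scan picks the same coordinate \<open>k\<close> times in a row, so \<open>k\<close> steps
  dominate a multiple of the mixture of the powers \<open>T i ^^ k\<close>; the latter is close to the mixture of the \<open>G i\<close>.
\<close>

lemma mix_power_contraction:
  fixes \<alpha> \<beta> :: "real ^ 'd::finite"
  assumes T: "\<And>i. markov_op N (T i)" and G: "\<And>i. markov_op N (G i)"
    and \<beta>: "\<beta> \<in> prob_simplex" and \<alpha>: "\<alpha> \<in> prob_simplex" "\<And>i. \<epsilon> \<le> \<alpha> $ i" and \<epsilon>: "0 < \<epsilon>"
    and near: "\<And>i f x. f \<in> unit_fun N \<Longrightarrow> x \<in> space N \<Longrightarrow> \<bar>(T i ^^ k) f x - G i f x\<bar> \<le> \<delta>"
    and \<delta>: "real n * \<delta> \<le> 1 / 8"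
    and ergodic: "\<And>f x. f \<in> unit_fun N \<Longrightarrow> x \<in> space N \<Longrightarrow> \<bar>(mix \<beta> G ^^ n) f x - e f\<bar> \<le> 1 / 8"
    and f: "f \<in> unit_fun N" and xy: "x \<in> space N" "y \<in> space N"
  shows "\<bar>(mix \<alpha> T ^^ (k * n)) f x - (mix \<alpha> T ^^ (k * n)) f y\<bar> \<le> 1 - \<epsilon> ^ (k * n) / 2"
proof -
  interpret Ti: markov_op N "T i" for i by (rule T)
  interpret Tk: markov_op N "T i ^^ k" for i by (rule Ti.power)
  interpret G: markov_op N "mix \<beta> G" by (intro mix_markov_op G \<beta>)
  interpret Gn: markov_op N "mix \<beta> G ^^ l" for l by (rule G.power)
  interpret U: markov_op N "mix \<alpha> T" by (intro mix_markov_op T \<alpha>)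
  interpret Un: markov_op N "mix \<alpha> T ^^ l" for l by (rule U.power)
  define V where "V = mix \<beta> (\<lambda>i. T i ^^ k)"
  interpret V: markov_op N V unfolding V_def by (intro mix_markov_op Ti.power \<beta>)
  interpret Vn: markov_op N "V ^^ l" for l by (rule V.power)
  have \<beta>': "\<And>i. 0 \<le> \<beta> $ i" "(\<Sum>i\<in>UNIV. \<beta> $ i) = 1" using \<beta> by (auto simp: prob_simplex_def)
  \<comment> \<open>Factors are exchanged one at a time: each exchange costs \<delta>, and the error
    made so far passes through a Gibbs step without growing.\<close>
  have VG: "\<bar>(V ^^ m) f x - (mix \<beta> G ^^ m) f x\<bar> \<le> real m * \<delta>"
    if f: "f \<in> unit_fun N" and x: "x \<in> space N" for f x m
    using x
  proof (induction m arbitrary: x)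
    case (Suc m)
    have "\<bar>V ((V ^^ m) f) x - mix \<beta> G ((V ^^ m) f) x\<bar> \<le> \<delta>"
      unfolding V_def[THEN fun_cong, THEN fun_cong, of "(V ^^ m) f" x]
      by (intro mix_diff_le \<beta> near Vn.unit f Suc.prems)
    moreover have "\<bar>mix \<beta> G ((V ^^ m) f) x - mix \<beta> G ((mix \<beta> G ^^ m) f) x\<bar> \<le> real m * \<delta>"
      by (intro G.nonexpansive Vn.closed Gn.closed unit_fun_bounded f Suc)
    ultimately show ?case by (simp add: algebra_simps)
  qed simp
  have V_near: "\<bar>(V ^^ n) f x - e f\<bar> \<le> 1 / 4" if "f \<in> unit_fun N" "x \<in> space N" for f x
    using VG[OF that, of n] ergodic[OF that] \<delta> by linarith
  have single: "\<epsilon> ^ m * (T i ^^ m) f x \<le> (mix \<alpha> T ^^ m) f x"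
    if f: "f \<in> unit_fun N" and x: "x \<in> space N" for f x m i
    using x
  proof (induction m arbitrary: x)
    case (Suc m)
    interpret Tm: markov_op N "T j ^^ m" for j by (rule Ti.power)
    have fb: "f \<in> bounded_fun N" using f by (rule unit_fun_bounded)
    \<comment> \<open>The summand 0 gives the argument of \<open>T i\<close> the shape expected by
      \<open>affine\<close>.\<close>
    have "\<epsilon> ^ Suc m * (T i ^^ Suc m) f x = \<epsilon> * T i (\<lambda>y. \<epsilon> ^ m * (T i ^^ m) f y + 0) x"
      using Suc.prems fb by (simp add: Ti.affine[where b=0, simplified] Tm.closed)
    also have "\<dots> \<le> \<epsilon> * T i ((mix \<alpha> T ^^ m) f) x"
    proof (intro mult_left_mono Ti.mono Un.closed fb Suc.prems)
      show "(\<lambda>y. \<epsilon> ^ m * (T i ^^ m) f y + 0) \<in> bounded_fun N"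
        using lincomb_bounded_fun[OF Tm.closed[OF fb] const_bounded_fun[of 0], of "\<epsilon> ^ m" _ 0] by simp
    qed (use Suc.IH \<epsilon> in auto)
    also have "\<dots> \<le> \<alpha> $ i * T i ((mix \<alpha> T ^^ m) f) x"
      using \<alpha> Un.unit[OF f, of m] Suc.prems unit_fun_bounded[OF Un.unit[OF f, of m]]
      by (intro mult_right_mono Ti.pos) (auto simp: unit_fun_def)
    also have "\<dots> \<le> mix \<alpha> T ((mix \<alpha> T ^^ m) f) x"
      unfolding mix_def[of \<alpha> T "(mix \<alpha> T ^^ m) f"]
      using \<alpha> Un.unit[OF f, of m] Suc.prems unit_fun_bounded[OF Un.unit[OF f, of m]]
      by (intro member_le_sum mult_nonneg_nonneg Ti.pos) (auto simp: unit_fun_def prob_simplex_def)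
    finally show ?case by simp
  qed simp
  have block: "\<epsilon> ^ k * V f x \<le> (mix \<alpha> T ^^ k) f x" if "f \<in> unit_fun N" "x \<in> space N" for f x
  proof -
    have "\<epsilon> ^ k * V f x = (\<Sum>i\<in>UNIV. \<beta> $ i * (\<epsilon> ^ k * (T i ^^ k) f x))"
      by (simp add: V_def mix_def sum_distrib_left mult_ac)
    also have "\<dots> \<le> (\<Sum>i\<in>UNIV. \<beta> $ i * (mix \<alpha> T ^^ k) f x)"
      by (intro sum_mono mult_left_mono single that \<beta>')
    also have "\<dots> = (mix \<alpha> T ^^ k) f x" using \<beta>' by (simp add: sum_distrib_right[symmetric])
    finally show ?thesis .
  qed
  have blocks: "\<epsilon> ^ (k * m) * (V ^^ m) f x \<le> (mix \<alpha> T ^^ (k * m)) f x"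
    if f: "f \<in> unit_fun N" and x: "x \<in> space N" for f x m
    using x
  proof (induction m arbitrary: x)
    case (Suc m)
    have fb: "f \<in> bounded_fun N" using f by (rule unit_fun_bounded)
    have "\<epsilon> ^ (k * Suc m) * (V ^^ Suc m) f x = \<epsilon> ^ (k * m) * (\<epsilon> ^ k * V ((V ^^ m) f) x)"
      by (simp add: power_add)
    also have "\<dots> \<le> \<epsilon> ^ (k * m) * (mix \<alpha> T ^^ k) ((V ^^ m) f) x"
      using \<epsilon> by (intro mult_left_mono block Vn.unit f Suc.prems) auto
    also have "\<dots> = (mix \<alpha> T ^^ k) (\<lambda>y. \<epsilon> ^ (k * m) * (V ^^ m) f y + 0) x"
      using Suc.prems fb by (simp add: Un.affine[where b=0, simplified] Vn.closed)
    also have "\<dots> \<le> (mix \<alpha> T ^^ k) ((mix \<alpha> T ^^ (k * m)) f) x"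
    proof (intro Un.mono Un.closed fb Suc.prems)
      show "(\<lambda>y. \<epsilon> ^ (k * m) * (V ^^ m) f y + 0) \<in> bounded_fun N"
        using lincomb_bounded_fun[OF Vn.closed[OF fb] const_bounded_fun[of 0], of "\<epsilon> ^ (k*m)" _ 0] by simp
    qed (use Suc.IH in auto)
    finally show ?case by (simp add: funpow_add)
  qed simp
  define c where "c = \<epsilon> ^ (k * n)"
  have c: "0 < c" using \<epsilon> by (simp add: c_def)
  have fb: "f \<in> bounded_fun N" using f by (rule unit_fun_bounded)
  \<comment> \<open>The domination is one-sided; applied to \<open>1 - f\<close> it yields the upper
    bound.\<close>
  have f': "(\<lambda>y. (-1) * f y + 1) \<in> unit_fun N" using f by (auto simp: unit_fun_def)
  \<comment> \<open>All values lie in one interval with these endpoints. The unknown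
    \<open>e f\<close> cancels from its length, which is \<open>1 - c / 2\<close>.\<close>
  have "c * (e f - 1 / 4) \<le> (mix \<alpha> T ^^ (k * n)) f x \<and>
    (mix \<alpha> T ^^ (k * n)) f x \<le> 1 - c * (1 - e f - 1 / 4)" if x: "x \<in> space N" for x
  proof
    have Vb: "e f - 1 / 4 \<le> (V ^^ n) f x" "1 - e f - 1 / 4 \<le> 1 - (V ^^ n) f x"
      using V_near[OF f x] by linarith+
    have "c * (e f - 1 / 4) \<le> c * (V ^^ n) f x"
      using c Vb by (intro mult_left_mono) auto
    then show "c * (e f - 1 / 4) \<le> (mix \<alpha> T ^^ (k * n)) f x"
      using blocks[OF f x, of n] by (simp add: c_def)
    have "c * (1 - e f - 1 / 4) \<le> c * (1 - (V ^^ n) f x)"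
      using c Vb by (intro mult_left_mono) auto
    also have "\<dots> \<le> 1 - (mix \<alpha> T ^^ (k * n)) f x"
      using blocks[OF f' x, of n] Vn.affine[OF fb x, of n "-1" 1] Un.affine[OF fb x, of "k * n" "-1" 1]
      by (simp add: c_def)
    finally show "(mix \<alpha> T ^^ (k * n)) f x \<le> 1 - c * (1 - e f - 1 / 4)" by simp
  qed
  from this[OF xy(1)] this[OF xy(2)] show ?thesis
    unfolding c_def[symmetric] right_diff_distrib by linarith
qed

section \<open>Integration against kernels\<close>

definition kernel_op :: "('s \<Rightarrow> 't measure) \<Rightarrow> ('t \<Rightarrow> real) \<Rightarrow> 's \<Rightarrow> real" where
  "kernel_op K f x = (\<integral>y. f y \<partial>K x)"

lemma kernelD:
  assumes "K \<in> N \<rightarrow>\<^sub>M prob_algebra L" "x \<in> space N"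
  shows "prob_space (K x)" "sets (K x) = sets L" "space (K x) = space L"
  using measurable_space[OF assms] by (auto simp: space_prob_algebra dest: sets_eq_imp_space_eq)

lemma integral_bind_bounded_fun:
  assumes "prob_space \<mu>" "K \<in> \<mu> \<rightarrow>\<^sub>M prob_algebra L" "f \<in> bounded_fun L"
  shows "(\<integral>y. f y \<partial>(\<mu> \<bind> K)) = (\<integral>x. kernel_op K f x \<partial>\<mu>)"
proof -
  interpret prob_space \<mu> by fact
  obtain b where b: "f \<in> borel_measurable L" "\<And>x. x \<in> space L \<Longrightarrow> \<bar>f x\<bar> \<le> b"
    using assms(3) by (auto simp: bounded_fun_def)
  show ?thesis unfolding kernel_op_def
  proof (rule integral_bind[where B'=1, OF b])
    show "K \<in> \<mu> \<rightarrow>\<^sub>M subprob_algebra L" by (rule measurable_prob_algebraD) fact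
    show "AE x in \<mu>. emeasure (K x) (space (K x)) \<le> ennreal 1"
      using kernelD(1)[OF assms(2)] by (intro AE_I2) (simp add: prob_space.emeasure_space_1)
  qed (use b in unfold_locales)
qed

text \<open>Measurability comes from reading the inner integral as one against the image of
  \<open>K x\<close> under \<open>y \<mapsto> (x, y)\<close>, which is again a measurable family of
  probability measures, now on the product.\<close>

lemma kernel_integral_bounded_fun:
  assumes K: "K \<in> N \<rightarrow>\<^sub>M prob_algebra L" and h: "h \<in> bounded_fun (N \<Otimes>\<^sub>M L)"
  shows "(\<lambda>x. \<integral>y. h (x, y) \<partial>K x) \<in> bounded_fun N"
proof -
  obtain b where hm[measurable]: "h \<in> borel_measurable (N \<Otimes>\<^sub>M L)"
    and b: "\<And>x. x \<in> space (N \<Otimes>\<^sub>M L) \<Longrightarrow> \<bar>h x\<bar> \<le> b"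
    using h by (auto simp: bounded_fun_def)
  have "(\<lambda>x. distr (K x) (N \<Otimes>\<^sub>M L) (Pair x)) \<in> N \<rightarrow>\<^sub>M prob_algebra (N \<Otimes>\<^sub>M L)"
    by (rule measurable_distr_prob_space2[OF K]) simp
  then have "(\<lambda>x. \<integral>z. h z \<partial>distr (K x) (N \<Otimes>\<^sub>M L) (Pair x)) \<in> borel_measurable N"
    by (intro measurable_compose[OF _ integral_measurable_subprob_algebra] measurable_prob_algebraD) auto
  moreover have "(\<integral>z. h z \<partial>distr (K x) (N \<Otimes>\<^sub>M L) (Pair x)) = (\<integral>y. h (x, y) \<partial>K x)" if x: "x \<in> space N" for x
  proof (rule integral_distr)
    show "Pair x \<in> K x \<rightarrow>\<^sub>M N \<Otimes>\<^sub>M L"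
      using measurable_Pair1'[OF x, of L] kernelD(2)[OF K x] by (simp cong: measurable_cong_sets)
  qed simp
  ultimately have m: "(\<lambda>x. \<integral>y. h (x, y) \<partial>K x) \<in> borel_measurable N"
    by (simp cong: measurable_cong)
  show ?thesis
  proof (rule bounded_funI[OF m, of b])
    fix x assume x: "x \<in> space N"
    have hx: "(\<lambda>y. h (x, y)) \<in> bounded_fun L"
      using x b by (intro bounded_funI[of _ _ b]) (auto simp: space_pair_measure)
    have "- b \<le> h (x, y)" "h (x, y) \<le> b" if "y \<in> space L" for y
      using b[of "(x, y)"] x that by (auto simp: space_pair_measure abs_le_iff)
    note bounded_fun_integral_bounds[OF kernelD(1,2)[OF K x] hx this]
    then show "\<bar>\<integral>y. h (x, y) \<partial>K x\<bar> \<le> b" by (simp add: abs_le_iff)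
  qed
qed

lemma bounded_fun_compose:
  assumes "f \<in> bounded_fun N" "g \<in> L \<rightarrow>\<^sub>M N"
  shows "(\<lambda>x. f (g x)) \<in> bounded_fun L"
  using assms measurable_space[OF assms(2)] by (auto simp: bounded_fun_def intro!: measurable_compose[OF assms(2)])

text \<open>The draw may live in a different space \<open>L\<close>, and \<phi> turns it into the
  next state. Taking \<open>\<phi> x y = y\<close> gives an ordinary kernel,
  \<open>\<phi> x y = x(i := y)\<close> an update of one coordinate.\<close>

lemma kernel_markov_op:
  assumes K: "K \<in> N \<rightarrow>\<^sub>M prob_algebra L" and \<phi>: "(\<lambda>(x, y). \<phi> x y) \<in> N \<Otimes>\<^sub>M L \<rightarrow>\<^sub>M N"
  shows "markov_op N (\<lambda>f x. \<integral>y. f (\<phi> x y) \<partial>K x)"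
proof
  have \<phi>x: "\<phi> x \<in> L \<rightarrow>\<^sub>M N" if "x \<in> space N" for x
    using measurable_compose[OF measurable_Pair1'[OF that] \<phi>] by simp
  show "(\<lambda>x. \<integral>y. f (\<phi> x y) \<partial>K x) \<in> bounded_fun N" if "f \<in> bounded_fun N" for f
    using kernel_integral_bounded_fun[OF K bounded_fun_compose[OF that \<phi>]] by simp
  fix f x assume f: "f \<in> bounded_fun N" and x: "x \<in> space N"
  note i = bounded_fun_integrable[OF kernelD(1,2)[OF K x] bounded_fun_compose[OF _ \<phi>x[OF x]]]
  show "(\<integral>y. a * f (\<phi> x y) + b * g (\<phi> x y) \<partial>K x) =
    a * (\<integral>y. f (\<phi> x y) \<partial>K x) + b * (\<integral>y. g (\<phi> x y) \<partial>K x)" if "g \<in> bounded_fun N" for g a b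
    using i[OF f] i[OF that] by simp
  show "0 \<le> (\<integral>y. f (\<phi> x y) \<partial>K x)" if "\<And>y. y \<in> space N \<Longrightarrow> 0 \<le> f y"
    using that measurable_space[OF \<phi>x[OF x]] kernelD(3)[OF K x]
    by (intro integral_nonneg_AE AE_I2) auto
next
  fix x assume x: "x \<in> space N"
  interpret prob_space "K x" by (rule kernelD[OF K x])
  show "(\<integral>y. 1 \<partial>K x) = (1 :: real)" by (simp add: prob_space)
qed

lemma kernel_op_markov_op: "K \<in> N \<rightarrow>\<^sub>M prob_algebra N \<Longrightarrow> markov_op N (kernel_op K)"
  using kernel_markov_op[of K N N "\<lambda>x y. y"] by (simp add: kernel_op_def[abs_def])

text \<open>Kernels compose by appending a last step, operators by applying it innermost:
  integrating \<open>f\<close> after \<open>Suc n\<close> steps is integrating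
  \<open>kernel_op K f\<close> after \<open>n\<close> steps. Hence the second induction varies
  \<open>f\<close>.\<close>

lemma kernel_pow_integral:
  assumes K: "K \<in> N \<rightarrow>\<^sub>M prob_algebra N" and x: "x \<in> space N"
  shows "kernel_pow N K n x \<in> space (prob_algebra N)"
    and "f \<in> bounded_fun N \<Longrightarrow> (\<integral>y. f y \<partial>kernel_pow N K n x) = (kernel_op K ^^ n) f x"
proof -
  interpret markov_op N "kernel_op K" by (rule kernel_op_markov_op[OF K])
  have *: "kernel_pow N K n x \<in> space (prob_algebra N)" for n
  proof (induction n)
    case 0
    show ?case using x by (auto simp: space_prob_algebra prob_space_return)
  next
    case (Suc n)
    then show ?case using K
      by (auto simp: space_prob_algebra prob_space_bind' intro!: sets_bind')
  qed
  show "kernel_pow N K n x \<in> space (prob_algebra N)" by fact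
  show "f \<in> bounded_fun N \<Longrightarrow> (\<integral>y. f y \<partial>kernel_pow N K n x) = (kernel_op K ^^ n) f x"
  proof (induction n arbitrary: f)
    case 0
    then show ?case using x by (auto simp: bounded_fun_def integral_return)
  next
    case (Suc n)
    have "K \<in> kernel_pow N K n x \<rightarrow>\<^sub>M prob_algebra N"
      using K *[of n] by (auto simp: space_prob_algebra cong: measurable_cong_sets)
    then have "(\<integral>y. f y \<partial>kernel_pow N K (Suc n) x) = (\<integral>y. kernel_op K f y \<partial>kernel_pow N K n x)"
      using *[of n] Suc.prems by (auto simp: space_prob_algebra intro!: integral_bind_bounded_fun)
    then show ?case using Suc.IH[OF closed[OF Suc.prems]] by (simp add: funpow_swap1)
  qed
qed

text \<open>The identity in \<open>regular_cond_distr\<close> says that the joint law of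
  \<open>U\<close> and \<open>V\<close> agrees on rectangles with the law of \<open>U\<close>
  extended by \<open>K\<close>. Rectangles are stable under intersection and generate the product,
  so the two laws coincide.\<close>

lemma regular_cond_distr_integral:
  assumes rc: "regular_cond_distr \<Omega> E U F V K" and \<Omega>: "prob_space \<Omega>"
    and U[measurable]: "U \<in> \<Omega> \<rightarrow>\<^sub>M E" and V[measurable]: "V \<in> \<Omega> \<rightarrow>\<^sub>M F" and h: "h \<in> bounded_fun (E \<Otimes>\<^sub>M F)"
  shows "(\<integral>w. h (U w, V w) \<partial>\<Omega>) = (\<integral>w. (\<integral>y. h (U w, y) \<partial>K (U w)) \<partial>\<Omega>)"
proof -
  interpret prob_space \<Omega> by fact
  have K: "K \<in> E \<rightarrow>\<^sub>M prob_algebra F" using rc by (simp add: regular_cond_distr_def)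
  have K'[measurable]: "K \<in> E \<rightarrow>\<^sub>M subprob_algebra F" by (rule measurable_prob_algebraD[OF K])
  define L where "L u = distr (K u) (E \<Otimes>\<^sub>M F) (Pair u)" for u
  have L: "L \<in> E \<rightarrow>\<^sub>M prob_algebra (E \<Otimes>\<^sub>M F)"
    unfolding L_def by (rule measurable_distr_prob_space2[OF K]) simp
  have P: "Pair u \<in> K u \<rightarrow>\<^sub>M E \<Otimes>\<^sub>M F" if "u \<in> space E" for u
    using measurable_Pair1'[OF that, of F] kernelD(2)[OF K that] by (simp cong: measurable_cong_sets)
  define J where "J = distr \<Omega> (E \<Otimes>\<^sub>M F) (\<lambda>w. (U w, V w))"
  have J: "prob_space J" unfolding J_def by (rule prob_space_distr) simp
  have D: "prob_space (distr \<Omega> E U)" by (rule prob_space_distr) simp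
  have D': "distr \<Omega> E U \<in> space (prob_algebra E)" using D by (simp add: space_prob_algebra)
  define G where "G = {a \<times> b | a b. a \<in> sets E \<and> b \<in> sets F}"
  have J_eq: "J = distr \<Omega> E U \<bind> L"
  proof (rule measure_eqI_generator_eq[where E=G and \<Omega>="space E \<times> space F" and A="\<lambda>_. space E \<times> space F"])
    show "Int_stable G" unfolding G_def by (rule Int_stable_pair_measure_generator)
    show "G \<subseteq> Pow (space E \<times> space F)" unfolding G_def by (rule pair_measure_closed)
    show "sets J = sigma_sets (space E \<times> space F) G" by (simp add: J_def G_def sets_pair_measure)
    show "sets (distr \<Omega> E U \<bind> L) = sigma_sets (space E \<times> space F) G"
      using sets_bind'[OF D' L] by (simp add: G_def sets_pair_measure)
    show "range (\<lambda>_. space E \<times> space F) \<subseteq> G" by (auto simp: G_def)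
    show "emeasure J (space E \<times> space F) \<noteq> \<infinity>" for i :: nat
      using finite_measure.emeasure_finite[OF prob_space.axioms(1)[OF J]] by simp
    fix X assume "X \<in> G"
    then obtain a b where ab: "a \<in> sets E" "b \<in> sets F" "X = a \<times> b" by (auto simp: G_def)
    have "emeasure J X = emeasure \<Omega> {w \<in> space \<Omega>. U w \<in> a \<and> V w \<in> b}"
      unfolding J_def using ab by (subst emeasure_distr) (auto intro!: arg_cong[where f="emeasure \<Omega>"])
    also have "\<dots> = (\<integral>\<^sup>+ w. indicator a (U w) * emeasure (K (U w)) b \<partial>\<Omega>)"
      using rc ab by (simp add: regular_cond_distr_def)
    also have "\<dots> = (\<integral>\<^sup>+ u. indicator a u * emeasure (K u) b \<partial>distr \<Omega> E U)"
      using ab by (subst nn_integral_distr) auto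
    also have "\<dots> = (\<integral>\<^sup>+ u. emeasure (L u) X \<partial>distr \<Omega> E U)"
    proof (rule nn_integral_cong)
      fix u assume "u \<in> space (distr \<Omega> E U)"
      then have u: "u \<in> space E" by simp
      have "emeasure (L u) X = emeasure (K u) (Pair u -` X \<inter> space (K u))"
        unfolding L_def using ab P[OF u] by (subst emeasure_distr) auto
      also have "Pair u -` X \<inter> space (K u) = (if u \<in> a then b else {})"
        using ab kernelD(3)[OF K u] sets.sets_into_space[OF ab(2)] by auto
      finally show "indicator a u * emeasure (K u) b = emeasure (L u) X" by (simp add: indicator_def)
    qed
    also have "\<dots> = emeasure (distr \<Omega> E U \<bind> L) X"
      using ab by (intro emeasure_bind_prob_algebra[OF D' L, symmetric]) auto
    finally show "emeasure J X = emeasure (distr \<Omega> E U \<bind> L) X" .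
  qed auto
  have hm[measurable]: "h \<in> borel_measurable (E \<Otimes>\<^sub>M F)" using h by (auto simp: bounded_fun_def)
  have "(\<integral>w. h (U w, V w) \<partial>\<Omega>) = (\<integral>z. h z \<partial>J)"
    unfolding J_def by (subst integral_distr) auto
  also have "\<dots> = (\<integral>u. kernel_op L h u \<partial>distr \<Omega> E U)"
    unfolding J_eq using D L h by (intro integral_bind_bounded_fun) (auto cong: measurable_cong_sets)
  also have "\<dots> = (\<integral>u. (\<integral>y. h (u, y) \<partial>K u) \<partial>distr \<Omega> E U)"
    using P by (intro Bochner_Integration.integral_cong) (auto simp: kernel_op_def L_def integral_distr)
  also have "\<dots> = (\<integral>w. (\<integral>y. h (U w, y) \<partial>K (U w)) \<partial>\<Omega>)"
    using kernel_integral_bounded_fun[OF K h] by (intro integral_distr) (auto simp: bounded_fun_def)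
  finally show ?thesis .
qed

section \<open>Coordinate updates and random scans\<close>

text \<open>The kernel of a coordinate receives the other coordinates and the current value, so that
  the Gibbs update, which ignores the latter, and the Metropolis update fit one scheme. Both
  arguments move with the state, whence the joint measurability.\<close>

definition scan_kernels ::
    "('d::finite \<Rightarrow> 'a measure) \<Rightarrow> ('d \<Rightarrow> ('d \<Rightarrow> 'a) \<Rightarrow> 'a \<Rightarrow> 'a measure) \<Rightarrow> bool" where
  "scan_kernels M \<kappa> \<longleftrightarrow> (\<forall>i. (\<lambda>(z, x). \<kappa> i z x) \<in> minus_space M i \<Otimes>\<^sub>M M i \<rightarrow>\<^sub>M prob_algebra (M i))"

definition coord_op ::
    "('d \<Rightarrow> ('d \<Rightarrow> 'a) \<Rightarrow> 'a \<Rightarrow> 'a measure) \<Rightarrow> 'd \<Rightarrow> (('d \<Rightarrow> 'a) \<Rightarrow> real) \<Rightarrow> ('d \<Rightarrow> 'a) \<Rightarrow> real" where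
  "coord_op \<kappa> i f x = (\<integral>y. f (x(i := y)) \<partial>\<kappa> i (minus_coord i x) (x i))"

lemma minus_coord_measurable [measurable]: "minus_coord i \<in> state_space M \<rightarrow>\<^sub>M minus_space M i"
  unfolding minus_coord_def[abs_def] by (rule measurable_restrict_subset) auto

lemma minus_coord_upd [simp]: "minus_coord i (x(i := y)) = minus_coord i x"
  by (auto simp: minus_coord_def restrict_def)

lemma update_measurable: "(\<lambda>(x, y). x(i := y)) \<in> state_space M \<Otimes>\<^sub>M M i \<rightarrow>\<^sub>M state_space M"
  using measurable_add_dim[of i UNIV M] by simp

lemma update_measurable1 [measurable]: "x \<in> space (state_space M) \<Longrightarrow> (\<lambda>y. x(i := y)) \<in> M i \<rightarrow>\<^sub>M state_space M"
  using measurable_compose[OF measurable_Pair1' update_measurable] by simp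

lemma minus_update_measurable: "(\<lambda>(z, y). z(i := y)) \<in> minus_space M i \<Otimes>\<^sub>M M i \<rightarrow>\<^sub>M state_space M"
  using measurable_add_dim[of i "- {i}" M] by (simp add: insert_absorb Compl_insert insert_Diff_if)

lemma scan_kernels_coord:
  assumes "scan_kernels M \<kappa>"
  shows "(\<lambda>x. \<kappa> i (minus_coord i x) (x i)) \<in> state_space M \<rightarrow>\<^sub>M prob_algebra (M i)"
proof -
  have *: "(\<lambda>(z, x). \<kappa> i z x) \<in> minus_space M i \<Otimes>\<^sub>M M i \<rightarrow>\<^sub>M prob_algebra (M i)"
    using assms by (simp add: scan_kernels_def)
  have "(\<lambda>x. (minus_coord i x, x i)) \<in> state_space M \<rightarrow>\<^sub>M minus_space M i \<Otimes>\<^sub>M M i" by measurable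
  from measurable_compose[OF this *] show ?thesis by simp
qed

lemma scan_kernels_fixed:
  assumes "scan_kernels M \<kappa>" "z \<in> space (minus_space M i)"
  shows "\<kappa> i z \<in> M i \<rightarrow>\<^sub>M prob_algebra (M i)"
proof -
  have *: "(\<lambda>(z, x). \<kappa> i z x) \<in> minus_space M i \<Otimes>\<^sub>M M i \<rightarrow>\<^sub>M prob_algebra (M i)"
    using assms by (simp add: scan_kernels_def)
  from measurable_compose[OF measurable_Pair1'[OF assms(2)] *] show ?thesis by simp
qed

lemma coord_op_markov_op: "scan_kernels M \<kappa> \<Longrightarrow> markov_op (state_space M) (coord_op \<kappa> i)"
  using kernel_markov_op[OF scan_kernels_coord update_measurable[where M=M and i=i]]
  by (simp only: coord_op_def[abs_def])

text \<open>Updating coordinate \<open>i\<close> leaves the other coordinates untouched, so all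
  \<open>k\<close> updates use the same kernel on \<open>M i\<close>. This reduces powers of a
  coordinate update to a chain on a single coordinate space.\<close>

lemma coord_op_power:
  "(coord_op \<kappa> i ^^ k) f x = (kernel_op (\<kappa> i (minus_coord i x)) ^^ k) (\<lambda>y. f (x(i := y))) (x i)"
proof (induction k arbitrary: x)
  case (Suc k)
  let ?K = "\<kappa> i (minus_coord i x)"
  have "coord_op \<kappa> i ((coord_op \<kappa> i ^^ k) f) x = (\<integral>y. (coord_op \<kappa> i ^^ k) f (x(i := y)) \<partial>?K (x i))"
    by (rule coord_op_def)
  also have "\<dots> = (\<integral>y. (kernel_op ?K ^^ k) (\<lambda>y. f (x(i := y))) y \<partial>?K (x i))"
    by (simp only: Suc minus_coord_upd fun_upd_same fun_upd_upd)
  also have "\<dots> = kernel_op ?K ((kernel_op ?K ^^ k) (\<lambda>y. f (x(i := y)))) (x i)"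
    by (rule kernel_op_def[symmetric])
  finally show ?case by (simp only: funpow.simps o_apply)
qed simp

lemma prob_simplex_pmf:
  assumes "\<alpha> \<in> prob_simplex"
  shows "pmf (embed_pmf (\<lambda>i. \<alpha> $ i)) i = \<alpha> $ i"
proof (rule pmf_embed_pmf)
  show "0 \<le> \<alpha> $ i" for i using assms by (simp add: prob_simplex_def)
  have "(\<integral>\<^sup>+ i. ennreal (\<alpha> $ i) \<partial>count_space UNIV) = (\<Sum>i\<in>UNIV. ennreal (\<alpha> $ i))"
    by (simp add: nn_integral_count_space_finite)
  also have "\<dots> = 1" using assms by (subst sum_ennreal) (auto simp: prob_simplex_def)
  finally show "(\<integral>\<^sup>+ i. ennreal (\<alpha> $ i) \<partial>count_space UNIV) = 1" .
qed

lemma random_scan_kernel_measurable: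
  assumes "scan_kernels M \<kappa>"
  shows "random_scan_kernel M \<kappa> \<alpha> \<in> state_space M \<rightarrow>\<^sub>M prob_algebra (state_space M)"
  unfolding random_scan_kernel_def[abs_def]
proof (rule measurable_bind_prob_space2)
  show "(\<lambda>x. measure_pmf (embed_pmf (\<lambda>i. \<alpha> $ i))) \<in> state_space M \<rightarrow>\<^sub>M prob_algebra (count_space UNIV)"
    by (auto simp: space_prob_algebra measure_pmf.prob_space_axioms)
  have "(\<lambda>x. distr (\<kappa> i (minus_coord i x) (x i)) (state_space M) (\<lambda>y. x(i := y)))
      \<in> state_space M \<rightarrow>\<^sub>M prob_algebra (state_space M)" for i
    by (rule measurable_distr_prob_space2[OF scan_kernels_coord[OF assms] update_measurable])
  then have *: "(\<lambda>e. distr (\<kappa> i (minus_coord i (fst e)) (fst e i)) (state_space M) (\<lambda>y. (fst e)(i := y)))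
      \<in> state_space M \<Otimes>\<^sub>M count_space UNIV \<rightarrow>\<^sub>M prob_algebra (state_space M)" for i
    by (rule measurable_compose[OF measurable_fst])
  \<comment> \<open>The coordinate takes finitely many values, so measurability in the state for
    each fixed coordinate is enough.\<close>
  show "(\<lambda>(x, i). distr (\<kappa> i (minus_coord i x) (x i)) (state_space M) (\<lambda>y. x(i := y)))
      \<in> state_space M \<Otimes>\<^sub>M count_space UNIV \<rightarrow>\<^sub>M prob_algebra (state_space M)"
    unfolding case_prod_beta' by (rule measurable_compose_countable'[OF * measurable_snd]) simp
qed

lemma random_scan_kernel_integral:
  assumes \<kappa>: "scan_kernels M \<kappa>" and \<alpha>: "\<alpha> \<in> prob_simplex"
    and f: "f \<in> bounded_fun (state_space M)" and x: "x \<in> space (state_space M)"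
  shows "(\<integral>y. f y \<partial>random_scan_kernel M \<kappa> \<alpha> x) = mix \<alpha> (coord_op \<kappa>) f x"
proof -
  have fm[measurable]: "f \<in> borel_measurable (state_space M)" using f by (simp add: bounded_fun_def)
  define D where "D i = distr (\<kappa> i (minus_coord i x) (x i)) (state_space M) (\<lambda>y. x(i := y))" for i
  have \<kappa>x: "prob_space (\<kappa> i (minus_coord i x) (x i))" "sets (\<kappa> i (minus_coord i x) (x i)) = sets (M i)" for i
    using kernelD[OF scan_kernels_coord[OF \<kappa>] x] by auto
  have up: "(\<lambda>y. x(i := y)) \<in> \<kappa> i (minus_coord i x) (x i) \<rightarrow>\<^sub>M state_space M" for i
    using update_measurable1[OF x] \<kappa>x by (simp cong: measurable_cong_sets)
  have D: "D \<in> measure_pmf (embed_pmf (\<lambda>i. \<alpha> $ i)) \<rightarrow>\<^sub>M prob_algebra (state_space M)"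
    using \<kappa>x up by (auto simp: D_def space_prob_algebra intro!: prob_space.prob_space_distr)
  have "(\<integral>y. f y \<partial>random_scan_kernel M \<kappa> \<alpha> x) = (\<integral>i. kernel_op D f i \<partial>measure_pmf (embed_pmf (\<lambda>i. \<alpha> $ i)))"
    unfolding random_scan_kernel_def D_def[symmetric, abs_def]
    by (rule integral_bind_bounded_fun[OF measure_pmf.prob_space_axioms D f])
  also have "\<dots> = (\<Sum>i\<in>UNIV. kernel_op D f i * \<alpha> $ i)"
    by (subst integral_measure_pmf_real[of UNIV]) (auto simp: prob_simplex_pmf[OF \<alpha>])
  also have "\<dots> = mix \<alpha> (coord_op \<kappa>) f x"
    unfolding mix_def coord_op_def kernel_op_def D_def
    using up by (intro sum.cong) (auto simp: integral_distr mult.commute)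
  finally show ?thesis .
qed

lemma random_scan_kernel_pow_integral:
  assumes \<kappa>: "scan_kernels M \<kappa>" and \<alpha>: "\<alpha> \<in> prob_simplex"
    and f: "f \<in> bounded_fun (state_space M)" and x: "x \<in> space (state_space M)"
  shows "(\<integral>y. f y \<partial>kernel_pow (state_space M) (random_scan_kernel M \<kappa> \<alpha>) n x) = (mix \<alpha> (coord_op \<kappa>) ^^ n) f x"
proof -
  let ?K = "kernel_op (random_scan_kernel M \<kappa> \<alpha>)" and ?U = "mix \<alpha> (coord_op \<kappa>)"
  interpret K: markov_op "state_space M" ?K
    by (rule kernel_op_markov_op[OF random_scan_kernel_measurable[OF \<kappa>]])
  interpret Kl: markov_op "state_space M" "?K ^^ l" for l by (rule K.power)
  interpret U: markov_op "state_space M" ?U by (rule mix_markov_op[OF coord_op_markov_op[OF \<kappa>] \<alpha>])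
  interpret Ul: markov_op "state_space M" "?U ^^ l" for l by (rule U.power)
  have "(?K ^^ l) f x = (?U ^^ l) f x" if "x \<in> space (state_space M)" for l x
    using that
  proof (induction l arbitrary: x)
    case (Suc l)
    have "?K ((?K ^^ l) f) x = ?K ((?U ^^ l) f) x"
      by (intro K.cong Kl.closed Ul.closed f Suc)
    then show ?case using random_scan_kernel_integral[OF \<kappa> \<alpha> Ul.closed[OF f] Suc.prems, of l]
      by (simp add: kernel_op_def[of _ "(?U ^^ l) f"])
  qed simp
  then show ?thesis
    using kernel_pow_integral(2)[OF random_scan_kernel_measurable[OF \<kappa>] x f] x by simp
qed

section \<open>Measurability of the Gibbs and Metropolis updates\<close>

lemma cond_kernel_scan_kernels:
  assumes "conditional_densities M \<pi> p"
  shows "scan_kernels M (\<lambda>i z x. cond_kernel M p i z)"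
  unfolding scan_kernels_def
proof
  fix i
  have "cond_kernel M p i \<in> minus_space M i \<rightarrow>\<^sub>M prob_algebra (M i)"
    using assms by (auto simp: conditional_densities_def regular_cond_distr_def)
  from measurable_compose[OF measurable_fst this]
  show "(\<lambda>(z, x). cond_kernel M p i z) \<in> minus_space M i \<Otimes>\<^sub>M M i \<rightarrow>\<^sub>M prob_algebra (M i)"
    by (simp add: case_prod_beta')
qed

lemma bernoulli_pmf_measurable:
  assumes [measurable]: "a \<in> borel_measurable N" and a: "\<And>x. x \<in> space N \<Longrightarrow> 0 \<le> a x \<and> a x \<le> 1"
  shows "(\<lambda>x. measure_pmf (bernoulli_pmf (a x))) \<in> N \<rightarrow>\<^sub>M prob_algebra (count_space UNIV)"
proof (rule measurable_prob_algebraI[OF _ measurable_subprob_algebra])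
  show "(\<lambda>x. emeasure (measure_pmf (bernoulli_pmf (a x))) A) \<in> borel_measurable N" for A
  proof -
    have "(\<lambda>x. \<Sum>s\<in>A. ennreal (if s then a x else 1 - a x)) \<in> borel_measurable N"
      by measurable
    moreover have "emeasure (measure_pmf (bernoulli_pmf (a x))) A = (\<Sum>s\<in>A. ennreal (if s then a x else 1 - a x))"
      if "x \<in> space N" for x
      using a[OF that] by (subst emeasure_measure_pmf_finite) (auto intro!: sum.cong simp del: sum_ennreal simp: sum_ennreal[symmetric])
    ultimately show ?thesis by (simp cong: measurable_cong)
  qed
qed (auto intro!: measure_pmf.prob_space_axioms measure_pmf.subprob_space_axioms)

text \<open>The kernel is a proposal followed by a coin flip, so what has to be checked is that the
  acceptance probability is jointly measurable in old value, proposal and remaining coordinates, and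
  lies in [0,1]. The facts \<open>p1\<close> to \<open>q2\<close> are the densities in the four
  arrangements that occur in the acceptance ratio.\<close>

lemma metropolis_kernel_scan_kernels:
  assumes p: "conditional_densities M \<pi> p" and q: "proposal_densities M q"
  shows "scan_kernels M (metropolis_kernel M p q)"
  unfolding scan_kernels_def
proof
  fix i
  let ?E = "minus_space M i \<Otimes>\<^sub>M M i"
  have pm[measurable]: "(\<lambda>(z, y). p i z y) \<in> borel_measurable (minus_space M i \<Otimes>\<^sub>M M i)"
    and p0: "\<And>z y. z \<in> space (minus_space M i) \<Longrightarrow> y \<in> space (M i) \<Longrightarrow> 0 \<le> p i z y"
    using p by (auto simp: conditional_densities_def)
  have qm[measurable]: "(\<lambda>(z, x, y). q i z x y) \<in> borel_measurable (minus_space M i \<Otimes>\<^sub>M M i \<Otimes>\<^sub>M M i)"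
    and q0: "\<And>z x y. z \<in> space (minus_space M i) \<Longrightarrow> x \<in> space (M i) \<Longrightarrow> y \<in> space (M i) \<Longrightarrow> 0 \<le> q i z x y"
    and qk: "(\<lambda>(z, x). density (M i) (\<lambda>y. ennreal (q i z x y))) \<in> ?E \<rightarrow>\<^sub>M prob_algebra (M i)"
    using q by (auto simp: proposal_densities_def)
  define a where "a = (\<lambda>((z, x), y). mh_accept (p i z) (q i z) x y)"
  have p1: "(\<lambda>((z, x), y). p i z x) \<in> borel_measurable (?E \<Otimes>\<^sub>M M i)"
    using measurable_compose[OF measurable_fst pm, of "M i"] by (simp add: case_prod_beta')
  have p2: "(\<lambda>((z, x), y). p i z y) \<in> borel_measurable (?E \<Otimes>\<^sub>M M i)"
    using measurable_compose[OF _ pm, of "\<lambda>((z, x), y). (z, y)" "?E \<Otimes>\<^sub>M M i"] by (simp add: case_prod_beta')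
  have q1: "(\<lambda>((z, x), y). q i z x y) \<in> borel_measurable (?E \<Otimes>\<^sub>M M i)"
    using measurable_compose[OF _ qm, of "\<lambda>((z, x), y). (z, x, y)" "?E \<Otimes>\<^sub>M M i"] by (simp add: case_prod_beta')
  have q2: "(\<lambda>((z, x), y). q i z y x) \<in> borel_measurable (?E \<Otimes>\<^sub>M M i)"
    using measurable_compose[OF _ qm, of "\<lambda>((z, x), y). (z, y, x)" "?E \<Otimes>\<^sub>M M i"] by (simp add: case_prod_beta')
  have am: "a \<in> borel_measurable (?E \<Otimes>\<^sub>M M i)"
    unfolding a_def mh_accept_def using p1 p2 q1 q2 by (simp add: case_prod_beta')
  have a01: "0 \<le> a e \<and> a e \<le> 1" if "e \<in> space (?E \<Otimes>\<^sub>M M i)" for e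
    using that p0 q0 by (auto simp: a_def mh_accept_def space_pair_measure)
  have "(\<lambda>(e, y). if y then snd e else snd (fst e)) \<in> (?E \<Otimes>\<^sub>M M i) \<Otimes>\<^sub>M count_space UNIV \<rightarrow>\<^sub>M M i"
    by measurable
  from measurable_distr_prob_space2[OF bernoulli_pmf_measurable[OF am a01] this]
  have step: "(\<lambda>e. distr (measure_pmf (bernoulli_pmf (a e))) (M i) (\<lambda>y. if y then snd e else snd (fst e)))
      \<in> ?E \<Otimes>\<^sub>M M i \<rightarrow>\<^sub>M prob_algebra (M i)" by simp
  have "(\<lambda>e. (case e of (z, x) \<Rightarrow> density (M i) (\<lambda>y. ennreal (q i z x y))) \<bind>
      (\<lambda>y. distr (measure_pmf (bernoulli_pmf (a (e, y)))) (M i) (\<lambda>b. if b then y else snd e)))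
      \<in> ?E \<rightarrow>\<^sub>M prob_algebra (M i)"
    using step by (intro measurable_bind_prob_space2[OF qk]) (simp add: case_prod_beta')
  then show "(\<lambda>(z, x). metropolis_kernel M p q i z x) \<in> ?E \<rightarrow>\<^sub>M prob_algebra (M i)"
    by (simp add: metropolis_kernel_def mh_kernel_def a_def case_prod_beta')
qed

section \<open>Simultaneous uniform ergodicity\<close>

lemma tv_dist_measure_diff_le:
  assumes "prob_space \<mu>" "prob_space \<nu>" "A \<in> sets N"
  shows "\<bar>measure \<mu> A - measure \<nu> A\<bar> \<le> tv_dist N \<mu> \<nu>"
  unfolding tv_dist_def
proof (rule cSUP_upper[OF assms(3)])
  show "bdd_above ((\<lambda>A. \<bar>measure \<mu> A - measure \<nu> A\<bar>) ` sets N)"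
  proof (rule bdd_aboveI2)
    fix B
    have "measure \<mu> B \<le> 1" "measure \<nu> B \<le> 1"
      using prob_space.prob_le_1 assms by blast+
    then show "\<bar>measure \<mu> B - measure \<nu> B\<bar> \<le> 1"
      using measure_nonneg[of \<mu> B] measure_nonneg[of \<nu> B] by linarith
  qed
qed

text \<open>Applied to the complement as well, the lower bound confines both measures of
  \<open>A\<close> to the interval of length \<open>1 - s\<close> that starts at
  \<open>s * measure \<nu> A\<close>.\<close>

lemma minorization_measure_diff_le:
  assumes \<mu>: "prob_space \<mu>" "sets \<mu> = sets N" and \<mu>': "prob_space \<mu>'" "sets \<mu>' = sets N"
    and \<nu>: "prob_space \<nu>" "sets \<nu> = sets N"
    and lower: "\<And>A. A \<in> sets N \<Longrightarrow> s * measure \<nu> A \<le> measure \<mu> A" "\<And>A. A \<in> sets N \<Longrightarrow> s * measure \<nu> A \<le> measure \<mu>' A"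
    and A: "A \<in> sets N"
  shows "\<bar>measure \<mu> A - measure \<mu>' A\<bar> \<le> 1 - s"
proof -
  have sp: "space \<mu> = space N" "space \<mu>' = space N" "space \<nu> = space N"
    using \<mu> \<mu>' \<nu> by (auto dest: sets_eq_imp_space_eq)
  have compl: "measure \<kappa> (space N - A) = 1 - measure \<kappa> A"
    if "prob_space \<kappa>" "sets \<kappa> = sets N" "space \<kappa> = space N" for \<kappa>
    using prob_space.prob_compl[OF that(1), of A] that A by simp
  have "space N - A \<in> sets N" using A by auto
  note lower(1)[OF this] lower(2)[OF this] lower[OF A]
  then have "s * (1 - measure \<nu> A) \<le> 1 - measure \<mu> A" "s * (1 - measure \<nu> A) \<le> 1 - measure \<mu>' A"
    "s * measure \<nu> A \<le> measure \<mu> A" "s * measure \<nu> A \<le> measure \<mu>' A"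
    using \<mu> \<mu>' \<nu> sp by (simp_all add: compl)
  then show ?thesis by (simp add: right_diff_distrib abs_le_iff)
qed

text \<open>These hypotheses mention neither the update rule nor a run, so the bounds derived from
  them hold for all starting values at once.\<close>

locale mwg_sampler =
  fixes M :: "'d::finite \<Rightarrow> 'a measure" and \<pi> :: "('d \<Rightarrow> 'a) measure"
    and p :: "'d \<Rightarrow> ('d \<Rightarrow> 'a) \<Rightarrow> 'a \<Rightarrow> real"
    and q :: "'d \<Rightarrow> ('d \<Rightarrow> 'a) \<Rightarrow> 'a \<Rightarrow> 'a \<Rightarrow> real"
    and \<epsilon> :: real
  assumes prob_\<pi>: "prob_space \<pi>" and sets_\<pi>: "sets \<pi> = sets (state_space M)"
    and cond_dens: "conditional_densities M \<pi> p" and prop_dens: "proposal_densities M q"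
    and eps: "0 < \<epsilon>" "\<epsilon> \<le> 1 / real CARD('d)"
    and gibbs: "\<exists>\<beta>\<in>selection_set \<epsilon>. uniformly_ergodic (state_space M) (RSG M p \<beta>) \<pi>"
    and metropolis: "\<forall>i.
        (\<forall>z\<in>space (minus_space M i).
           uniformly_ergodic (M i) (metropolis_kernel M p q i z) (cond_kernel M p i z)) \<and>
        (\<exists>s>0. \<exists>m::nat. \<forall>z\<in>space (minus_space M i).
           \<exists>\<nu>. prob_space \<nu> \<and> sets \<nu> = sets (M i) \<and>
             (\<forall>x\<in>space (M i). \<forall>A\<in>sets (M i).
                measure (kernel_pow (M i) (metropolis_kernel M p q i z) m x) A \<ge> s * measure \<nu> A))"
begin

abbreviation S where "S \<equiv> state_space M"
abbreviation T where "T \<equiv> coord_op (metropolis_kernel M p q)"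
abbreviation G where "G \<equiv> coord_op (\<lambda>i z x. cond_kernel M p i z)"

lemmas metropolis_scan = metropolis_kernel_scan_kernels[OF cond_dens prop_dens]
  and gibbs_scan = cond_kernel_scan_kernels[OF cond_dens]

lemma cond_kernelD:
  assumes "z \<in> space (minus_space M i)"
  shows "prob_space (cond_kernel M p i z)" "sets (cond_kernel M p i z) = sets (M i)"
  using cond_dens kernelD[of "cond_kernel M p i" "minus_space M i" "M i" z] assms
  by (auto simp: conditional_densities_def regular_cond_distr_def)

lemma minus_coord_space: "x \<in> space S \<Longrightarrow> minus_coord i x \<in> space (minus_space M i)"
  by (rule measurable_space[OF minus_coord_measurable])

lemma coord_space: "x \<in> space S \<Longrightarrow> x i \<in> space (M i)"
  by (auto simp: space_PiM)

lemma update_bounded_fun: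
  "f \<in> bounded_fun S \<Longrightarrow> x \<in> space S \<Longrightarrow> (\<lambda>y. f (x(i := y))) \<in> bounded_fun (M i)"
  by (rule bounded_fun_compose[OF _ update_measurable1])

section \<open>Invariance of \<pi> under the coordinate updates\<close>

text \<open>Redrawing coordinate \<open>i\<close> from its conditional law given the others does not
  change the joint law; \<open>f\<close> is read as a function of the pair formed by the other
  coordinates and coordinate \<open>i\<close>.\<close>

lemma integral_gibbs:
  assumes f: "f \<in> bounded_fun S"
  shows "(\<integral>x. G i f x \<partial>\<pi>) = (\<integral>x. f x \<partial>\<pi>)"
proof -
  have upd: "(minus_coord i x)(i := y) = x(i := y)" for x y by (auto simp: minus_coord_def)
  have rc: "regular_cond_distr \<pi> (minus_space M i) (minus_coord i) (M i) (\<lambda>x. x i) (cond_kernel M p i)"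
    using cond_dens by (simp add: conditional_densities_def)
  have m: "minus_coord i \<in> \<pi> \<rightarrow>\<^sub>M minus_space M i" "(\<lambda>x. x i) \<in> \<pi> \<rightarrow>\<^sub>M M i"
    using minus_coord_measurable[of i M] measurable_component_singleton[of i UNIV M] sets_\<pi>
    by (auto cong: measurable_cong_sets)
  have "(\<lambda>(z, y). f (z(i := y))) \<in> bounded_fun (minus_space M i \<Otimes>\<^sub>M M i)"
    using bounded_fun_compose[OF f minus_update_measurable] by (simp add: case_prod_beta')
  from regular_cond_distr_integral[OF rc prob_\<pi> m this] show ?thesis
    by (simp add: coord_op_def upd)
qed

text \<open>Invariance of the conditional law is part of \<open>uniformly_ergodic\<close>, so it is
  read off from the hypothesis on the Metropolis kernels instead of being derived from detailed
  balance.\<close>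

lemma integral_cond_metropolis:
  assumes z: "z \<in> space (minus_space M i)" and g: "g \<in> bounded_fun (M i)"
  shows "(\<integral>y. kernel_op (metropolis_kernel M p q i z) g y \<partial>cond_kernel M p i z) = (\<integral>y. g y \<partial>cond_kernel M p i z)"
proof -
  have "metropolis_kernel M p q i z \<in> cond_kernel M p i z \<rightarrow>\<^sub>M prob_algebra (M i)"
    using scan_kernels_fixed[OF metropolis_scan z] cond_kernelD(2)[OF z] by (simp cong: measurable_cong_sets)
  from integral_bind_bounded_fun[OF cond_kernelD(1)[OF z] this g]
  show ?thesis using metropolis z by (simp add: uniformly_ergodic_def)
qed

text \<open>Conditional invariance gives \<open>G i (T i f) = G i f\<close> on the state space, and
  integration against \<pi> removes \<open>G i\<close> from both sides.\<close>

lemma integral_metropolis: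
  assumes f: "f \<in> bounded_fun S"
  shows "(\<integral>x. T i f x \<partial>\<pi>) = (\<integral>x. f x \<partial>\<pi>)"
proof -
  interpret T: markov_op S "T i" by (rule coord_op_markov_op[OF metropolis_scan])
  have "G i (T i f) x = G i f x" if x: "x \<in> space S" for x
  proof -
    have "G i (T i f) x = (\<integral>y. kernel_op (metropolis_kernel M p q i (minus_coord i x)) (\<lambda>y. f (x(i := y))) y
        \<partial>cond_kernel M p i (minus_coord i x))"
      by (simp add: coord_op_def kernel_op_def)
    also have "\<dots> = G i f x"
      unfolding coord_op_def
      by (rule integral_cond_metropolis[OF minus_coord_space[OF x] update_bounded_fun[OF f x]])
    finally show ?thesis .
  qed
  then have "(\<integral>x. G i (T i f) x \<partial>\<pi>) = (\<integral>x. G i f x \<partial>\<pi>)"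
    using sets_eq_imp_space_eq[OF sets_\<pi>] by (intro Bochner_Integration.integral_cong) auto
  then show ?thesis using integral_gibbs[OF T.closed[OF f]] integral_gibbs[OF f] by simp
qed

lemma integral_mix_metropolis:
  assumes f: "f \<in> bounded_fun S" and \<alpha>: "\<alpha> \<in> prob_simplex"
  shows "(\<integral>x. mix \<alpha> T f x \<partial>\<pi>) = (\<integral>x. f x \<partial>\<pi>)"
proof -
  interpret T: markov_op S "T i" for i by (rule coord_op_markov_op[OF metropolis_scan])
  have "(\<integral>x. mix \<alpha> T f x \<partial>\<pi>) = (\<Sum>i\<in>UNIV. \<alpha> $ i * (\<integral>x. T i f x \<partial>\<pi>))"
    unfolding mix_def
    using bounded_fun_integrable[OF prob_\<pi> sets_\<pi> T.closed[OF f]] by simp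
  also have "\<dots> = (\<integral>x. f x \<partial>\<pi>)"
    using \<alpha> by (simp add: integral_metropolis[OF f] sum_distrib_right[symmetric] prob_simplex_def)
  finally show ?thesis .
qed

section \<open>Approximation of Gibbs updates by Metropolis powers\<close>

text \<open>The minorization bounds the oscillation after \<open>m\<close> steps by
  \<open>1 - s\<close>, with \<open>m\<close> and \<open>s\<close> common to all \<open>z\<close>.
  The threshold \<open>m * j\<close> therefore does not depend on \<open>z\<close>, whereas the
  rates in the ergodicity hypothesis may.\<close>

lemma metropolis_power_near_cond:
  assumes \<delta>: "0 < \<delta>"
  shows "\<exists>k0. \<forall>k\<ge>k0. \<forall>z\<in>space (minus_space M i). \<forall>x\<in>space (M i). \<forall>g\<in>unit_fun (M i).
    \<bar>(kernel_op (metropolis_kernel M p q i z) ^^ k) g x - (\<integral>y. g y \<partial>cond_kernel M p i z)\<bar> \<le> \<delta>"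
proof -
  obtain s' :: real and m :: nat where s': "s' > 0"
    and minor: "\<forall>z\<in>space (minus_space M i).
           \<exists>\<nu>. prob_space \<nu> \<and> sets \<nu> = sets (M i) \<and>
             (\<forall>x\<in>space (M i). \<forall>A\<in>sets (M i).
                measure (kernel_pow (M i) (metropolis_kernel M p q i z) m x) A \<ge> s' * measure \<nu> A)"
    using metropolis by blast
  \<comment> \<open>The cap at 1 and the factor 1/2 in \<open>r\<close> keep \<open>r\<close>
    strictly positive, as the contraction argument divides by powers of \<open>r\<close>.\<close>
  define s where "s = min s' 1"
  have s: "0 < s" "s \<le> 1" "s \<le> s'" using s' by (auto simp: s_def)
  define r where "r = 1 - s / 2"
  have r: "0 < r" "r < 1" using s by (auto simp: r_def)
  obtain j where j: "r ^ j < \<delta>" using real_arch_pow_inv[OF \<delta> r(2)] by blast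
  have "\<bar>(kernel_op (metropolis_kernel M p q i z) ^^ k) g x - (\<integral>y. g y \<partial>cond_kernel M p i z)\<bar> \<le> \<delta>"
    if k: "m * j \<le> k" and z: "z \<in> space (minus_space M i)" and x: "x \<in> space (M i)" and g: "g \<in> unit_fun (M i)"
    for k z x g
  proof -
    let ?K = "metropolis_kernel M p q i z"
    have K: "?K \<in> M i \<rightarrow>\<^sub>M prob_algebra (M i)" by (rule scan_kernels_fixed[OF metropolis_scan z])
    interpret K: markov_op "M i" "kernel_op ?K" by (rule kernel_op_markov_op[OF K])
    obtain \<nu> where \<nu>: "prob_space \<nu>" "sets \<nu> = sets (M i)"
      and low: "\<And>x A. x \<in> space (M i) \<Longrightarrow> A \<in> sets (M i) \<Longrightarrow> s' * measure \<nu> A \<le> measure (kernel_pow (M i) ?K m x) A"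
      using minor z by blast
    have low': "s * measure \<nu> A \<le> measure (kernel_pow (M i) ?K m x) A"
      if "x \<in> space (M i)" "A \<in> sets (M i)" for x A
      using low[OF that] mult_right_mono[OF s(3), of "measure \<nu> A"] by simp
    have "\<bar>(kernel_op ?K ^^ k) g x - (\<integral>y. g y \<partial>cond_kernel M p i z)\<bar> \<le> r ^ j"
    proof (rule K.power_near_stationary[OF r(1) _ cond_kernelD[OF z] integral_cond_metropolis[OF z] g x k])
      fix f x y assume f: "f \<in> unit_fun (M i)" and xy: "x \<in> space (M i)" "y \<in> space (M i)"
      have pr: "prob_space (kernel_pow (M i) ?K m x)" "sets (kernel_pow (M i) ?K m x) = sets (M i)"
        if "x \<in> space (M i)" for x
        using kernel_pow_integral(1)[OF K that, of m] by (auto simp: space_prob_algebra)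
      have "\<bar>(\<integral>u. f u \<partial>kernel_pow (M i) ?K m x) - (\<integral>u. f u \<partial>kernel_pow (M i) ?K m y)\<bar> \<le> 1 - s"
        by (rule integral_diff_le_of_measure_diff_le[OF pr[OF xy(1)] pr[OF xy(2)] _ f],
            rule minorization_measure_diff_le[OF pr[OF xy(1)] pr[OF xy(2)] \<nu> low'[OF xy(1)] low'[OF xy(2)]])
      then have "\<bar>(kernel_op ?K ^^ m) f x - (kernel_op ?K ^^ m) f y\<bar> \<le> 1 - s"
        by (simp add: kernel_pow_integral(2)[OF K] xy unit_fun_bounded[OF f])
      then show "\<bar>(kernel_op ?K ^^ m) f x - (kernel_op ?K ^^ m) f y\<bar> \<le> r"
        using s by (simp add: r_def)
    qed
    then show ?thesis using j by simp
  qed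
  then show ?thesis by blast
qed

lemma metropolis_power_near_gibbs:
  assumes \<delta>: "0 < \<delta>"
  shows "\<exists>k. \<forall>i. \<forall>f\<in>unit_fun S. \<forall>x\<in>space S. \<bar>(T i ^^ k) f x - G i f x\<bar> \<le> \<delta>"
proof -
  obtain k0 where k0: "\<And>i k z x g. k0 i \<le> k \<Longrightarrow> z \<in> space (minus_space M i) \<Longrightarrow> x \<in> space (M i) \<Longrightarrow> g \<in> unit_fun (M i) \<Longrightarrow>
      \<bar>(kernel_op (metropolis_kernel M p q i z) ^^ k) g x - (\<integral>y. g y \<partial>cond_kernel M p i z)\<bar> \<le> \<delta>"
    using metropolis_power_near_cond[OF \<delta>] by metis
  \<comment> \<open>A common exponent exists because there are finitely many coordinates and each
    \<open>k0 i\<close> is a threshold, not just one good exponent.\<close>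
  define k where "k = Max (range k0)"
  have "\<bar>(T i ^^ k) f x - G i f x\<bar> \<le> \<delta>" if f: "f \<in> unit_fun S" and x: "x \<in> space S" for i f x
  proof -
    have "(\<lambda>y. f (x(i := y))) \<in> unit_fun (M i)"
      using f measurable_compose[OF update_measurable1[OF x, of i]] measurable_space[OF update_measurable1[OF x, of i]]
      by (auto simp: unit_fun_def)
    from k0[OF _ minus_coord_space[OF x] coord_space[OF x] this, of k]
    show ?thesis by (simp add: k_def coord_op_power) (simp add: coord_op_def)
  qed
  then show ?thesis by blast
qed

lemma gibbs_power_near:
  assumes "0 < \<delta>"
  shows "\<exists>\<beta>\<in>prob_simplex. \<exists>n. \<forall>f\<in>unit_fun S. \<forall>x\<in>space S. \<bar>(mix \<beta> G ^^ n) f x - (\<integral>x. f x \<partial>\<pi>)\<bar> \<le> \<delta>"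
proof -
  obtain \<beta> C \<rho> where \<beta>: "\<beta> \<in> prob_simplex" and \<rho>: "0 \<le> \<rho>" "\<rho> < 1"
    and tv: "\<And>x n. x \<in> space S \<Longrightarrow> tv_dist S (kernel_pow S (RSG M p \<beta>) n x) \<pi> \<le> C * \<rho> ^ n"
    using gibbs unfolding uniformly_ergodic_def selection_set_def by blast
  have "(\<lambda>n. C * \<rho> ^ n) \<longlonglongrightarrow> C * 0" using \<rho> by (intro tendsto_intros LIMSEQ_realpow_zero)
  then have "eventually (\<lambda>n. C * \<rho> ^ n < \<delta>) sequentially" using assms by (intro order_tendstoD) auto
  then obtain n where n: "C * \<rho> ^ n < \<delta>" by (auto simp: eventually_sequentially)
  have "\<bar>(mix \<beta> G ^^ n) f x - (\<integral>x. f x \<partial>\<pi>)\<bar> \<le> \<delta>" if f: "f \<in> unit_fun S" and x: "x \<in> space S" for f x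
  proof -
    let ?\<mu> = "kernel_pow S (RSG M p \<beta>) n x"
    have K: "RSG M p \<beta> \<in> S \<rightarrow>\<^sub>M prob_algebra S"
      unfolding RSG_def by (rule random_scan_kernel_measurable[OF gibbs_scan])
    have \<mu>: "prob_space ?\<mu>" "sets ?\<mu> = sets S"
      using kernel_pow_integral(1)[OF K x, of n] by (auto simp: space_prob_algebra)
    have "\<bar>measure ?\<mu> A - measure \<pi> A\<bar> \<le> \<delta>" if "A \<in> sets S" for A
      using tv_dist_measure_diff_le[OF \<mu>(1) prob_\<pi> that] tv[OF x, of n] n by linarith
    from integral_diff_le_of_measure_diff_le[OF \<mu> prob_\<pi> sets_\<pi> this f]
    show ?thesis
      unfolding RSG_def
      using random_scan_kernel_pow_integral[OF gibbs_scan \<beta> unit_fun_bounded[OF f] x, of n] by simp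
  qed
  then show ?thesis using \<beta> by blast
qed

text \<open>The constants \<beta>, \<open>n\<close>, \<delta>, \<open>k\<close>, \<open>r\<close>
  and \<open>j\<close> are fixed in this order, and \<alpha> is introduced only afterwards; so
  \<open>k * n * j\<close> steps suffice for all admissible weights.\<close>

theorem simultaneous_uniform_ergodicity:
  assumes e: "0 < e"
  shows "\<exists>n. \<forall>\<alpha>\<in>selection_set \<epsilon>. \<forall>f\<in>unit_fun S. \<forall>x\<in>space S. \<bar>(mix \<alpha> T ^^ n) f x - (\<integral>x. f x \<partial>\<pi>)\<bar> \<le> e"
proof -
  obtain \<beta> n where \<beta>: "\<beta> \<in> prob_simplex"
    and n: "\<And>f x. f \<in> unit_fun S \<Longrightarrow> x \<in> space S \<Longrightarrow> \<bar>(mix \<beta> G ^^ n) f x - (\<integral>x. f x \<partial>\<pi>)\<bar> \<le> 1 / 8"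
    using gibbs_power_near[of "1/8"] by auto
  \<comment> \<open>The added 1 keeps the denominator positive when \<open>n = 0\<close>.\<close>
  define \<delta> where "\<delta> = 1 / (8 * (real n + 1))"
  have \<delta>: "0 < \<delta>" "real n * \<delta> \<le> 1 / 8" by (auto simp: \<delta>_def field_simps)
  obtain k where k: "\<And>i f x. f \<in> unit_fun S \<Longrightarrow> x \<in> space S \<Longrightarrow> \<bar>(T i ^^ k) f x - G i f x\<bar> \<le> \<delta>"
    using metropolis_power_near_gibbs[OF \<delta>(1)] by blast
  define r where "r = 1 - \<epsilon> ^ (k * n) / 2"
  \<comment> \<open>From \<epsilon> at most 1 it follows that \<open>r\<close> is at least 1/2,
    hence positive.\<close>
  have "1 / real CARD('d) \<le> 1" by (simp add: divide_le_eq)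
  then have "\<epsilon> \<le> 1" using eps by linarith
  then have "\<epsilon> ^ (k * n) \<le> 1" using eps by (intro power_le_one) auto
  then have r: "0 < r" "r < 1" using eps by (auto simp: r_def)
  obtain j where j: "r ^ j < e" using real_arch_pow_inv[OF e r(2)] by blast
  have "\<bar>(mix \<alpha> T ^^ (k * n * j)) f x - (\<integral>x. f x \<partial>\<pi>)\<bar> \<le> e"
    if \<alpha>: "\<alpha> \<in> selection_set \<epsilon>" and f: "f \<in> unit_fun S" and x: "x \<in> space S" for \<alpha> f x
  proof -
    have \<alpha>': "\<alpha> \<in> prob_simplex" "\<And>i. \<epsilon> \<le> \<alpha> $ i" using \<alpha> by (auto simp: selection_set_def)
    note T = coord_op_markov_op[OF metropolis_scan] and G = coord_op_markov_op[OF gibbs_scan]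
    interpret U: markov_op S "mix \<alpha> T" by (intro mix_markov_op T \<alpha>')
    have "\<bar>(mix \<alpha> T ^^ (k * n * j)) f x - (\<integral>x. f x \<partial>\<pi>)\<bar> \<le> r ^ j"
    proof (rule U.power_near_stationary[OF r(1) _ prob_\<pi> sets_\<pi> integral_mix_metropolis[OF _ \<alpha>'(1)] f x order_refl])
      show "\<bar>(mix \<alpha> T ^^ (k * n)) f x - (mix \<alpha> T ^^ (k * n)) f y\<bar> \<le> r"
        if "f \<in> unit_fun S" "x \<in> space S" "y \<in> space S" for f x y
        unfolding r_def by (rule mix_power_contraction[OF T G \<beta> \<alpha>' eps(1) k \<delta>(2) n that])
    qed
    then show ?thesis using j by simp
  qed
  then show ?thesis by blast
qed

end

section \<open>Runs of the adaptive sampler\<close>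

lemma markov_op_power_unit: "markov_op N T \<Longrightarrow> f \<in> unit_fun N \<Longrightarrow> (T ^^ n) f \<in> unit_fun N"
  using markov_op.unit[OF markov_op.power] .

lemma norm_sum_differences_le:
  fixes a :: "nat \<Rightarrow> 'v::real_normed_vector"
  assumes "m \<le> n" "\<And>k. m \<le> k \<Longrightarrow> k < n \<Longrightarrow> norm (a (Suc k) - a k) \<le> c"
  shows "norm (a n - a m) \<le> real (n - m) * c"
  using assms
proof (induction n)
  case (Suc n)
  show ?case
  proof (cases "m \<le> n")
    case True
    have "norm (a (Suc n) - a m) \<le> norm (a (Suc n) - a n) + norm (a n - a m)"
      using norm_triangle_ineq[of "a (Suc n) - a n" "a n - a m"] by simp
    also have "\<dots> \<le> c + real (n - m) * c"
      using Suc True by (intro add_mono) auto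
    finally show ?thesis using True by (simp add: Suc_diff_le algebra_simps)
  next
    case False
    then have "m = Suc n" using Suc.prems by simp
    then show ?thesis by simp
  qed
qed simp

locale mwg_run = mwg_sampler M \<pi> p q \<epsilon> + prob_space \<Omega>
  for M :: "'d::finite \<Rightarrow> 'a measure" and \<pi> p q \<epsilon> and \<Omega> :: "'w measure" +
  fixes R :: "nat \<Rightarrow> real ^ 'd \<Rightarrow> (nat \<Rightarrow> 'd \<Rightarrow> 'a) \<Rightarrow> real ^ 'd"
    and x0 :: "'d \<Rightarrow> 'a" and \<alpha>0 :: "real ^ 'd" and X :: "nat \<Rightarrow> 'w \<Rightarrow> 'd \<Rightarrow> 'a"
  assumes update: "update_rule M (selection_set \<epsilon>) R"
    and start: "\<alpha>0 \<in> selection_set \<epsilon>"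
    and run: "AdapRSMwG M p q R x0 \<alpha>0 \<Omega> X"
begin

abbreviation Y :: "(real ^ 'd) set" where "Y \<equiv> selection_set \<epsilon>"
abbreviation hist where "hist m w \<equiv> (\<lambda>k\<in>{..m}. X k w)"

definition weight :: "nat \<Rightarrow> 'w \<Rightarrow> real ^ 'd" where
  "weight n w = adaptive_weights R \<alpha>0 n (\<lambda>k. X k w)"

text \<open>The weights with index \<open>n\<close> are computed from the states before time
  \<open>n\<close>, whence the bound \<open>Suc m\<close>: the history up to \<open>m\<close>
  already determines the weights of the step out of \<open>X m\<close>.\<close>

lemma adaptive_weights_measurable:
  "n \<le> Suc m \<Longrightarrow> adaptive_weights R \<alpha>0 n \<in> history_space M m \<rightarrow>\<^sub>M restrict_space borel Y"
proof (induction n)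
  case 0
  show ?case using start by (simp add: space_restrict_space)
next
  case (Suc n)
  have "(\<lambda>h. (adaptive_weights R \<alpha>0 n h, restrict h {..n}))
      \<in> history_space M m \<rightarrow>\<^sub>M restrict_space borel Y \<Otimes>\<^sub>M history_space M n"
    using Suc by (intro measurable_Pair measurable_restrict_subset) auto
  moreover have "(\<lambda>(\<alpha>, h). R (Suc n) \<alpha> h) \<in> restrict_space borel Y \<Otimes>\<^sub>M history_space M n \<rightarrow>\<^sub>M restrict_space borel Y"
    using update by (simp add: update_rule_def)
  ultimately have "(\<lambda>h. case (adaptive_weights R \<alpha>0 n h, restrict h {..n}) of (\<alpha>, h) \<Rightarrow> R (Suc n) \<alpha> h)
      \<in> history_space M m \<rightarrow>\<^sub>M restrict_space borel Y"
    by (rule measurable_compose)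
  then show ?case by simp
qed

lemma adaptive_weights_restrict:
  "n \<le> Suc m \<Longrightarrow> adaptive_weights R \<alpha>0 n (restrict h {..m}) = adaptive_weights R \<alpha>0 n h"
proof (induction n)
  case (Suc n)
  then have "restrict (restrict h {..m}) {..n} = restrict h {..n}"
    by (auto simp: restrict_def fun_eq_iff)
  then show ?case using Suc by (simp del: restrict_apply)
qed simp

lemma weight_hist: "n \<le> Suc m \<Longrightarrow> adaptive_weights R \<alpha>0 n (hist m w) = weight n w"
  using adaptive_weights_restrict[of n m "\<lambda>k. X k w"] by (simp add: weight_def)

lemma X_measurable [measurable]: "X n \<in> \<Omega> \<rightarrow>\<^sub>M S"
  using run by (simp add: AdapRSMwG_def)

lemma hist_measurable: "hist m \<in> \<Omega> \<rightarrow>\<^sub>M history_space M m"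
  by (rule measurable_restrict) simp

lemma weight_measurable: "weight n \<in> \<Omega> \<rightarrow>\<^sub>M restrict_space borel Y"
  using measurable_compose[OF hist_measurable adaptive_weights_measurable[of n n]] weight_hist[of n n]
  by simp

lemma weight_borel [measurable]: "weight n \<in> borel_measurable \<Omega>"
  using weight_measurable by (simp add: measurable_restrict_space2_iff)

lemma weight_in: "w \<in> space \<Omega> \<Longrightarrow> weight n w \<in> Y"
  using measurable_space[OF weight_measurable] by (simp add: space_restrict_space)

lemma weight_change: "weight_change R \<alpha>0 X n w = norm (weight (Suc n) w - weight n w)"
  by (simp add: weight_change_def weight_def)

lemma selection_simplex: "\<alpha> \<in> Y \<Longrightarrow> \<alpha> \<in> prob_simplex"
  by (simp add: selection_set_def)

lemma mix_T_markov_op: "\<alpha> \<in> Y \<Longrightarrow> markov_op S (mix \<alpha> T)"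
  by (intro mix_markov_op coord_op_markov_op metropolis_scan selection_simplex)

section \<open>Joint measurability in weights and state\<close>

text \<open>The parameter is carried along unchanged while coordinate \<open>i\<close> is redrawn,
  so integration against the Metropolis kernel can take place on the product with the parameter
  space. Random weights can be substituted later because of this.\<close>

lemma coord_parametric_bounded_fun:
  assumes F: "(\<lambda>(\<alpha>, x). F \<alpha> x) \<in> bounded_fun (N \<Otimes>\<^sub>M S)"
  shows "(\<lambda>(\<alpha>, x). T i (F \<alpha>) x) \<in> bounded_fun (N \<Otimes>\<^sub>M S)"
proof -
  have K: "(\<lambda>e. metropolis_kernel M p q i (minus_coord i (snd e)) (snd e i)) \<in> N \<Otimes>\<^sub>M S \<rightarrow>\<^sub>M prob_algebra (M i)"
    by (rule measurable_compose[OF measurable_snd scan_kernels_coord[OF metropolis_scan]])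
  have "(\<lambda>u. (snd (fst u), snd u)) \<in> (N \<Otimes>\<^sub>M S) \<Otimes>\<^sub>M M i \<rightarrow>\<^sub>M S \<Otimes>\<^sub>M M i" by measurable
  from measurable_compose[OF this update_measurable]
  have "(\<lambda>u. (snd (fst u))(i := snd u)) \<in> (N \<Otimes>\<^sub>M S) \<Otimes>\<^sub>M M i \<rightarrow>\<^sub>M S" by simp
  from measurable_Pair[OF measurable_compose[OF measurable_fst measurable_fst] this]
  have "(\<lambda>u. (fst (fst u), (snd (fst u))(i := snd u))) \<in> (N \<Otimes>\<^sub>M S) \<Otimes>\<^sub>M M i \<rightarrow>\<^sub>M N \<Otimes>\<^sub>M S" .
  from kernel_integral_bounded_fun[OF K bounded_fun_compose[OF F this]]
  show ?thesis by (simp add: coord_op_def case_prod_beta')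
qed

lemma weight_component_measurable:
  "(\<lambda>\<alpha> :: real ^ 'd. \<alpha> $ i) \<in> borel_measurable (restrict_space borel Y)"
  by (rule measurable_restrict_space1, rule borel_measurable_continuous_onI) (intro continuous_intros)

lemma mix_power_unit_fun:
  assumes f: "f \<in> unit_fun S"
  shows "(\<lambda>(\<alpha>, x). (mix \<alpha> T ^^ l) f x) \<in> unit_fun (restrict_space borel Y \<Otimes>\<^sub>M S)"
proof -
  let ?N = "restrict_space borel Y \<Otimes>\<^sub>M S"
  have range: "(mix \<alpha> T ^^ l) f \<in> unit_fun S" if "\<alpha> \<in> Y" for \<alpha> l
    by (rule markov_op_power_unit[OF mix_T_markov_op[OF that] f])
  have "(\<lambda>(\<alpha>, x). (mix \<alpha> T ^^ l) f x) \<in> borel_measurable ?N"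
  proof (induction l)
    case 0
    show ?case using f by (auto simp: unit_fun_def)
  next
    case (Suc l)
    have "(\<lambda>(\<alpha>, x). (mix \<alpha> T ^^ l) f x) \<in> bounded_fun ?N"
      using Suc range by (intro bounded_funI[of _ _ 1]) (auto simp: space_pair_measure space_restrict_space unit_fun_def)
    from coord_parametric_bounded_fun[OF this]
    have "(\<lambda>e. T i ((mix (fst e) T ^^ l) f) (snd e)) \<in> borel_measurable ?N" for i
      by (simp add: bounded_fun_def case_prod_beta')
    moreover have "(\<lambda>e. fst e $ i) \<in> borel_measurable ?N" for i
      by (rule measurable_compose[OF measurable_fst weight_component_measurable])
    ultimately have "(\<lambda>e. \<Sum>i\<in>UNIV. fst e $ i * T i ((mix (fst e) T ^^ l) f) (snd e)) \<in> borel_measurable ?N"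
      by (intro borel_measurable_sum borel_measurable_times)
    then show ?case
      unfolding case_prod_beta' funpow.simps o_apply mix_def[of \<alpha> T "(mix \<alpha> T ^^ l) f" for \<alpha>] .
  qed
  then show ?thesis
    using range by (auto simp: unit_fun_def space_pair_measure space_restrict_space)
qed

lemma expectation_step:
  assumes f: "f \<in> unit_fun S" and m: "n \<le> m"
  shows "expectation (\<lambda>w. (mix (weight (Suc n) w) T ^^ l) f (X (Suc m) w))
    = expectation (\<lambda>w. mix (weight (Suc m) w) T ((mix (weight (Suc n) w) T ^^ l) f) (X m w))"
proof -
  let ?h = "\<lambda>(h, y). (mix (adaptive_weights R \<alpha>0 (Suc n) h) T ^^ l) f y"
  let ?K = "\<lambda>h. RSMwG M p q (adaptive_weights R \<alpha>0 (Suc m) h) (h m)"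
  have rc: "regular_cond_distr \<Omega> (history_space M m) (hist m) S (X (Suc m)) ?K"
    using run by (simp add: AdapRSMwG_def)
  have "(\<lambda>e. (adaptive_weights R \<alpha>0 (Suc n) (fst e), snd e))
      \<in> history_space M m \<Otimes>\<^sub>M S \<rightarrow>\<^sub>M restrict_space borel Y \<Otimes>\<^sub>M S"
    using m by (intro measurable_Pair measurable_compose[OF measurable_fst adaptive_weights_measurable] measurable_snd) auto
  from bounded_fun_compose[OF unit_fun_bounded[OF mix_power_unit_fun[OF f]] this, of l]
  have h: "?h \<in> bounded_fun (history_space M m \<Otimes>\<^sub>M S)" by (simp add: case_prod_beta')
  have "expectation (\<lambda>w. ?h (hist m w, X (Suc m) w)) = expectation (\<lambda>w. \<integral>y. ?h (hist m w, y) \<partial>?K (hist m w))"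
    by (rule regular_cond_distr_integral[OF rc prob_space_axioms hist_measurable X_measurable h])
  also have "\<dots> = expectation (\<lambda>w. mix (weight (Suc m) w) T ((mix (weight (Suc n) w) T ^^ l) f) (X m w))"
  proof (rule Bochner_Integration.integral_cong[OF refl])
    fix w assume w: "w \<in> space \<Omega>"
    have "(mix (weight (Suc n) w) T ^^ l) f \<in> bounded_fun S"
      by (intro unit_fun_bounded markov_op_power_unit mix_T_markov_op weight_in w f)
    from random_scan_kernel_integral[OF metropolis_scan selection_simplex[OF weight_in[OF w]] this measurable_space[OF X_measurable w]]
    show "(\<integral>y. ?h (hist m w, y) \<partial>?K (hist m w)) = mix (weight (Suc m) w) T ((mix (weight (Suc n) w) T ^^ l) f) (X m w)"
      using m by (simp add: weight_hist RSMwG_def del: adaptive_weights.simps)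
  qed
  finally show ?thesis using m by (simp add: weight_hist del: adaptive_weights.simps)
qed

definition big_change :: "real \<Rightarrow> nat \<Rightarrow> 'w set" where
  "big_change \<eta> k = {w \<in> space \<Omega>. weight_change R \<alpha>0 X k w > \<eta>}"

lemma big_change_sets [measurable]: "big_change \<eta> k \<in> sets \<Omega>"
  unfolding big_change_def weight_change by measurable

text \<open>Either no change in the window exceeds \<eta>, and each coordinate drifts by at most
  \<open>N * \<eta>\<close>; or some change does, and the l1 distance of two probability vectors, at
  most 2, is charged to the indicator of that event. The window starts at \<open>Suc n\<close>
  because \<open>weight (Suc n)\<close> governs the step out of \<open>X n\<close>.\<close>

lemma weight_drift_le:
  assumes w: "w \<in> space \<Omega>" and m: "n \<le> m" "m < n + N" and \<eta>: "0 \<le> \<eta>"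
  shows "(\<Sum>i\<in>UNIV. \<bar>weight (Suc m) w $ i - weight (Suc n) w $ i\<bar>)
    \<le> real CARD('d) * real N * \<eta> + 2 * (\<Sum>k\<in>{Suc n..<Suc n + N}. indicator (big_change \<eta> k) w)"
proof (cases "\<exists>k\<in>{Suc n..<Suc n + N}. w \<in> big_change \<eta> k")
  case True
  then obtain k where k: "k \<in> {Suc n..<Suc n + N}" "w \<in> big_change \<eta> k" by blast
  have simplex: "\<And>i. 0 \<le> weight n w $ i" "(\<Sum>i\<in>UNIV. weight n w $ i) = 1" for n
    using selection_simplex[OF weight_in[OF w]] by (auto simp: prob_simplex_def)
  have "(\<Sum>i\<in>UNIV. \<bar>weight (Suc m) w $ i - weight (Suc n) w $ i\<bar>) \<le> (\<Sum>i\<in>UNIV. weight (Suc m) w $ i + weight (Suc n) w $ i)"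
  proof (rule sum_mono)
    show "\<bar>weight (Suc m) w $ i - weight (Suc n) w $ i\<bar> \<le> weight (Suc m) w $ i + weight (Suc n) w $ i" for i
      using simplex(1)[of "Suc m" i] simplex(1)[of "Suc n" i] by linarith
  qed
  also have "\<dots> = 2" by (simp add: sum.distrib simplex)
  also have "1 \<le> (\<Sum>k\<in>{Suc n..<Suc n + N}. indicator (big_change \<eta> k) w :: real)"
    using member_le_sum[OF k(1), of "\<lambda>k. indicator (big_change \<eta> k) w :: real"] k(2) by simp
  then have "2 \<le> real CARD('d) * real N * \<eta> + 2 * (\<Sum>k\<in>{Suc n..<Suc n + N}. indicator (big_change \<eta> k) w)"
  proof -
    have "0 \<le> real CARD('d) * real N * \<eta>" using \<eta> by simp
    with \<open>1 \<le> _\<close> show ?thesis by linarith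
  qed
  finally show ?thesis .
next
  case False
  have "norm (weight (Suc m) w - weight (Suc n) w) \<le> real (Suc m - Suc n) * \<eta>"
  proof (rule norm_sum_differences_le)
    show "norm (weight (Suc k) w - weight k w) \<le> \<eta>" if "Suc n \<le> k" "k < Suc m" for k
    proof -
      have "k \<in> {Suc n..<Suc n + N}" using that m by auto
      then have "w \<notin> big_change \<eta> k" using False by blast
      then show ?thesis using w by (simp add: big_change_def weight_change)
    qed
  qed (use m in simp)
  also have "\<dots> \<le> real N * \<eta>" using m \<eta> by (intro mult_right_mono) auto
  finally have "\<bar>weight (Suc m) w $ i - weight (Suc n) w $ i\<bar> \<le> real N * \<eta>" for i
    using component_le_norm_cart[of "weight (Suc m) w - weight (Suc n) w" i] by simp
  then have "(\<Sum>i\<in>UNIV. \<bar>weight (Suc m) w $ i - weight (Suc n) w $ i\<bar>) \<le> (\<Sum>i\<in>(UNIV :: 'd set). real N * \<eta>)"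
    by (rule sum_mono)
  also have "\<dots> \<le> real CARD('d) * real N * \<eta> + 2 * (\<Sum>k\<in>{Suc n..<Suc n + N}. indicator (big_change \<eta> k) w)"
    by (simp add: sum_nonneg)
  finally show ?thesis .
qed

text \<open>
  The weights are frozen at time \<open>n + 1\<close>: exchanging, one step at a time, the frozen chain for the
  adaptive one changes the expectation by at most the drift of the weights since then.
\<close>

lemma adaptive_measure_diff_le:
  assumes near: "\<And>\<alpha> f x. \<alpha> \<in> Y \<Longrightarrow> f \<in> unit_fun S \<Longrightarrow> x \<in> space S \<Longrightarrow> \<bar>(mix \<alpha> T ^^ N) f x - (\<integral>x. f x \<partial>\<pi>)\<bar> \<le> \<delta>"
    and \<eta>: "0 \<le> \<eta>" and A: "A \<in> sets S"
  shows "\<bar>measure (distr \<Omega> S (X (n + N))) A - measure \<pi> A\<bar>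
    \<le> \<delta> + real N * (real CARD('d) * real N * \<eta> + 2 * (\<Sum>k\<in>{Suc n..<Suc n + N}. prob (big_change \<eta> k)))"
proof -
  define f :: "('d \<Rightarrow> 'a) \<Rightarrow> real" where "f = indicator A"
  have f: "f \<in> unit_fun S" unfolding f_def by (rule indicator_unit_fun[OF A])
  let ?W = "weight (Suc n)"
  define B where "B = real CARD('d) * real N * \<eta> + 2 * (\<Sum>k\<in>{Suc n..<Suc n + N}. prob (big_change \<eta> k))"
  define a where "a j = expectation (\<lambda>w. (mix (?W w) T ^^ (N - j)) f (X (n + j) w))" for j
  have frozen: "(mix (?W w) T ^^ l) f \<in> unit_fun S" if "w \<in> space \<Omega>" for w l
    by (intro markov_op_power_unit mix_T_markov_op weight_in that f)
  have frozen_bf: "(\<lambda>w. (mix (?W w) T ^^ l) f (X j w)) \<in> bounded_fun \<Omega>" for l j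
    using bounded_fun_compose[OF unit_fun_bounded[OF mix_power_unit_fun[OF f]] measurable_Pair[OF weight_measurable X_measurable], of l "Suc n" j]
    by simp
  have coord_le: "\<bar>T i ((mix (?W w) T ^^ l) f) x\<bar> \<le> 1" if "w \<in> space \<Omega>" "x \<in> space S" for i w l x
    using markov_op.unit[OF coord_op_markov_op[OF metropolis_scan] frozen[OF that(1)], of i l] that(2)
    by (auto simp: unit_fun_def)
  have step: "\<bar>a (Suc j) - a j\<bar> \<le> B" if j: "j < N" for j
  proof -
    obtain l where l: "N - j = Suc l" "N - Suc j = l" using j by (metis Suc_diff_Suc)
    let ?g = "\<lambda>w. mix (weight (Suc (n + j)) w) T ((mix (?W w) T ^^ l) f) (X (n + j) w)"
    let ?g' = "\<lambda>w. (mix (?W w) T ^^ Suc l) f (X (n + j) w)"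
    let ?b = "\<lambda>w. real CARD('d) * real N * \<eta> + 2 * (\<Sum>k\<in>{Suc n..<Suc n + N}. indicator (big_change \<eta> k) w)"
    have diff: "\<bar>?g w - ?g' w\<bar> \<le> ?b w" if w: "w \<in> space \<Omega>" for w
    proof -
      have "\<bar>?g w - mix (?W w) T ((mix (?W w) T ^^ l) f) (X (n + j) w)\<bar>
          \<le> (\<Sum>i\<in>UNIV. \<bar>weight (Suc (n + j)) w $ i - ?W w $ i\<bar>)"
        by (rule mix_weights_diff_le, rule coord_le[OF w measurable_space[OF X_measurable w]])
      also have "\<dots> \<le> ?b w" using j by (intro weight_drift_le w \<eta>) auto
      finally show ?thesis by simp
    qed
    have g'i: "integrable \<Omega> ?g'"
      by (rule bounded_fun_integrable[OF prob_space_axioms refl frozen_bf])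
    have gm: "?g \<in> borel_measurable \<Omega>"
    proof -
      have "(\<lambda>w. T i ((mix (?W w) T ^^ l) f) (X (n + j) w)) \<in> borel_measurable \<Omega>" for i
        using bounded_fun_compose[OF coord_parametric_bounded_fun[OF unit_fun_bounded[OF mix_power_unit_fun[OF f]]]
            measurable_Pair[OF weight_measurable X_measurable], of i l "Suc n" "n + j"]
        by (simp add: bounded_fun_def)
      then show ?thesis
        unfolding mix_def[of _ T "(mix (?W w) T ^^ l) f" for w]
        by (intro borel_measurable_sum borel_measurable_times measurable_compose[OF weight_measurable weight_component_measurable])
    qed
    have ii: "integrable \<Omega> (indicator (big_change \<eta> k) :: _ \<Rightarrow> real)" for k
      by (simp add: integrable_indicator_iff emeasure_eq_measure)
    then have bi: "integrable \<Omega> ?b"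
      by (intro Bochner_Integration.integrable_add integrable_const integrable_mult_right Bochner_Integration.integrable_sum)
    have gi: "integrable \<Omega> ?g"
    proof (rule integrable_const_bound[OF AE_I2 gm, of 1])
      show "norm (?g w) \<le> 1" if w: "w \<in> space \<Omega>" for w
        using markov_op.unit[OF mix_T_markov_op[OF weight_in[OF w]] frozen[OF w], of "Suc (n + j)" l]
          measurable_space[OF X_measurable w, of "n + j"] by (auto simp: unit_fun_def)
    qed
    \<comment> \<open>By \<open>expectation_step\<close>, the last adaptive step in
      \<open>a (Suc j)\<close> becomes an operator; both expectations are then evaluated at
      \<open>X (n + j)\<close> and differ in the weights of one step only.\<close>
    have "a (Suc j) - a j = expectation ?g - expectation ?g'"
      unfolding a_def l using expectation_step[OF f, of n "n + j" l] by simp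
    also have "\<dots> = expectation (\<lambda>w. ?g w - ?g' w)" by (rule Bochner_Integration.integral_diff[OF gi g'i, symmetric])
    finally have "\<bar>a (Suc j) - a j\<bar> = \<bar>expectation (\<lambda>w. ?g w - ?g' w)\<bar>" by simp
    also have "\<dots> \<le> expectation (\<lambda>w. \<bar>?g w - ?g' w\<bar>)" by (rule integral_abs_bound)
    also have "\<dots> \<le> expectation ?b"
      using diff by (intro integral_mono integrable_abs Bochner_Integration.integrable_diff gi g'i bi) auto
    also have "\<dots> = B"
      using ii by (simp add: B_def prob_space del: sum.op_ivl_Suc)
    finally show ?thesis .
  qed
  have "\<bar>a j - a 0\<bar> \<le> real j * B" if "j \<le> N" for j
    using norm_sum_differences_le[of 0 j a B] step that by simp
  then have "\<bar>a N - a 0\<bar> \<le> real N * B" by simp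
  moreover have "\<bar>a 0 - (\<integral>x. f x \<partial>\<pi>)\<bar> \<le> \<delta>"
  proof -
    have "- \<delta> + (\<integral>x. f x \<partial>\<pi>) \<le> (mix (?W w) T ^^ N) f (X n w)" "(mix (?W w) T ^^ N) f (X n w) \<le> \<delta> + (\<integral>x. f x \<partial>\<pi>)"
      if "w \<in> space \<Omega>" for w
      using near[OF weight_in[OF that, of "Suc n"] f measurable_space[OF X_measurable[of n] that]]
      by (simp_all add: abs_le_iff)
    from bounded_fun_integral_bounds[OF prob_space_axioms refl frozen_bf this]
    show ?thesis by (simp add: a_def abs_le_iff)
  qed
  moreover have "a N = measure (distr \<Omega> S (X (n + N))) A"
  proof -
    have "a N = (\<integral>x. f x \<partial>distr \<Omega> S (X (n + N)))"
      unfolding a_def using f by (subst integral_distr) (auto simp: unit_fun_def)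
    then show ?thesis using A by (simp add: f_def)
  qed
  moreover have "(\<integral>x. f x \<partial>\<pi>) = measure \<pi> A"
    using A sets_\<pi> sets.sets_into_space[of A \<pi>] by (simp add: f_def Int_absorb2)
  ultimately show ?thesis unfolding B_def[symmetric] by linarith
qed

end

section \<open>Convergence of the adaptive sampler\<close>

text \<open>The bounds \<open>b\<close> alone determine \<open>n0\<close>, before the update rule,
  the starting values and the run are given. The same statement thus yields convergence of one run
  and uniform convergence, according to the sequences supplied for \<open>b\<close>.\<close>

lemma (in mwg_sampler) adaptive_measure_diff_eventually_le:
  fixes \<Omega> :: "'w measure"
  assumes b: "\<And>\<eta>. 0 < \<eta> \<Longrightarrow> b \<eta> \<longlonglongrightarrow> 0" and e: "0 < e"
  shows "\<exists>n0. \<forall>n\<ge>n0. \<forall>R x0 \<alpha>0 X. mwg_run M \<pi> p q \<epsilon> \<Omega> R x0 \<alpha>0 X \<longrightarrow>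
    (\<forall>\<eta>>0. \<forall>k. measure \<Omega> {w \<in> space \<Omega>. weight_change R \<alpha>0 X k w > \<eta>} \<le> b \<eta> k) \<longrightarrow>
    (\<forall>A\<in>sets S. \<bar>measure (distr \<Omega> S (X n)) A - measure \<pi> A\<bar> \<le> e)"
proof -
  obtain N where N: "\<And>\<alpha> f x. \<alpha> \<in> selection_set \<epsilon> \<Longrightarrow> f \<in> unit_fun S \<Longrightarrow> x \<in> space S \<Longrightarrow>
      \<bar>(mix \<alpha> T ^^ N) f x - (\<integral>x. f x \<partial>\<pi>)\<bar> \<le> e / 3"
    using simultaneous_uniform_ergodicity[of "e / 3"] e by auto
  define c where "c = real N * (real CARD('d) * real N)"
  have c: "0 \<le> c" by (simp add: c_def)
  \<comment> \<open>The part of the bound caused by small changes is \<open>c * \<eta>\<close>; this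
    choice makes it at most \<open>e / 3\<close>, also when \<open>c = 0\<close>.\<close>
  define \<eta> where "\<eta> = e / (3 * (c + 1))"
  have \<eta>: "0 < \<eta>" using e c by (simp add: \<eta>_def)
  have "c * \<eta> \<le> (c + 1) * \<eta>" using \<eta> by (intro mult_right_mono) auto
  also have "\<dots> = e / 3" using c by (simp add: \<eta>_def add_nonneg_eq_0_iff field_simps)
  finally have c\<eta>: "c * \<eta> \<le> e / 3" .
  \<comment> \<open>With \<open>N\<close> and \<eta> fixed, this is a finite sum of null
    sequences.\<close>
  have "(\<lambda>n. real N * (2 * (\<Sum>k<N. b \<eta> (n + Suc k)))) \<longlonglongrightarrow> real N * (2 * (\<Sum>k<N. 0))"
    by (intro tendsto_intros LIMSEQ_ignore_initial_segment b \<eta>)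
  then have "eventually (\<lambda>n. real N * (2 * (\<Sum>k<N. b \<eta> (n + Suc k))) < e / 3) sequentially"
    using e by (intro order_tendstoD) auto
  then obtain n1 where n1: "\<And>n. n1 \<le> n \<Longrightarrow> real N * (2 * (\<Sum>k<N. b \<eta> (n + Suc k))) < e / 3"
    by (auto simp: eventually_sequentially)
  have "\<bar>measure (distr \<Omega> S (X n)) A - measure \<pi> A\<bar> \<le> e"
    if n: "n1 + N \<le> n" and run: "mwg_run M \<pi> p q \<epsilon> \<Omega> R x0 \<alpha>0 X"
      and small: "\<forall>\<eta>>0. \<forall>k. measure \<Omega> {w \<in> space \<Omega>. weight_change R \<alpha>0 X k w > \<eta>} \<le> b \<eta> k"
      and A: "A \<in> sets S" for n R x0 \<alpha>0 X A
  proof -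
    interpret run: mwg_run M \<pi> p q \<epsilon> \<Omega> R x0 \<alpha>0 X by fact
    define m where "m = n - N"
    have m: "n = m + N" "n1 \<le> m" using n by (auto simp: m_def)
    have "(\<Sum>k\<in>{Suc m..<Suc m + N}. measure \<Omega> (run.big_change \<eta> k)) \<le> (\<Sum>k\<in>{Suc m..<Suc m + N}. b \<eta> k)"
      using small \<eta> by (intro sum_mono) (auto simp: run.big_change_def)
    also have "\<dots> = (\<Sum>k<N. b \<eta> (m + Suc k))"
      by (rule sum.reindex_bij_witness[where i="\<lambda>k. m + Suc k" and j="\<lambda>k. k - Suc m"]) auto
    finally have "real N * (2 * (\<Sum>k\<in>{Suc m..<Suc m + N}. measure \<Omega> (run.big_change \<eta> k)))
        \<le> real N * (2 * (\<Sum>k<N. b \<eta> (m + Suc k)))"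
      by (intro mult_left_mono) auto
    then have "real N * (real CARD('d) * real N * \<eta> + 2 * (\<Sum>k\<in>{Suc m..<Suc m + N}. measure \<Omega> (run.big_change \<eta> k)))
        \<le> e / 3 + e / 3"
      using c\<eta> n1[OF m(2)] by (simp add: distrib_left c_def mult.assoc del: sum.op_ivl_Suc)
    moreover have "\<bar>measure (distr \<Omega> S (X n)) A - measure \<pi> A\<bar>
        \<le> e / 3 + real N * (real CARD('d) * real N * \<eta> + 2 * (\<Sum>k\<in>{Suc m..<Suc m + N}. measure \<Omega> (run.big_change \<eta> k)))"
      unfolding m(1) by (rule run.adaptive_measure_diff_le[OF N _ A]) (use \<eta> in auto)
    ultimately show ?thesis by linarith
  qed
  then show ?thesis by blast
qed

lemma tv_dist_le:
  assumes "\<And>A. A \<in> sets N \<Longrightarrow> \<bar>measure \<mu> A - measure \<nu> A\<bar> \<le> c"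
  shows "tv_dist N \<mu> \<nu> \<le> c"
  unfolding tv_dist_def using assms sets.empty_sets[of N] by (intro cSUP_least) auto

lemma tv_dist_nonneg:
  assumes "prob_space \<mu>" "prob_space \<nu>"
  shows "0 \<le> tv_dist N \<mu> \<nu>"
  using tv_dist_measure_diff_le[OF assms sets.empty_sets[of N]] by simp

text \<open>A bound on all weight changes makes the supremum over starting values in (a') a genuine
  supremum of a bounded set of reals.\<close>

lemma norm_prob_simplex_diff_le:
  fixes u v :: "real ^ 'd::finite"
  assumes "u \<in> prob_simplex" "v \<in> prob_simplex"
  shows "norm (u - v) \<le> 2"
proof -
  have norm_le: "norm w \<le> 1" if "w \<in> prob_simplex" for w :: "real ^ 'd"
    using norm_le_l1_cart[of w] that by (simp add: prob_simplex_def)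
  show ?thesis using norm_triangle_ineq4[of u v] norm_le[OF assms(1)] norm_le[OF assms(2)] by linarith
qed

theorem theorem5p2:
  fixes M :: "'d::finite \<Rightarrow> 'a measure"
    and \<pi> :: "('d \<Rightarrow> 'a) measure"
    and p :: "'d \<Rightarrow> ('d \<Rightarrow> 'a) \<Rightarrow> 'a \<Rightarrow> real"
    and q :: "'d \<Rightarrow> ('d \<Rightarrow> 'a) \<Rightarrow> 'a \<Rightarrow> 'a \<Rightarrow> real"
    and R :: "nat \<Rightarrow> real ^ 'd \<Rightarrow> (nat \<Rightarrow> 'd \<Rightarrow> 'a) \<Rightarrow> real ^ 'd"
    and \<epsilon> :: real
    and x0 :: "'d \<Rightarrow> 'a" and \<alpha>0 :: "real ^ 'd"
    and \<Omega> :: "'w measure"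
    and X :: "('d \<Rightarrow> 'a) \<Rightarrow> real ^ 'd \<Rightarrow> nat \<Rightarrow> 'w \<Rightarrow> 'd \<Rightarrow> 'a"
  defines "S \<equiv> state_space M"
    and "Y \<equiv> (selection_set \<epsilon> :: (real ^ 'd) set)"
  assumes "countably_generated S"
    and "prob_space \<pi>" and "sets \<pi> = sets S"
    and "conditional_densities M \<pi> p"
    and "proposal_densities M q"
    and "0 < \<epsilon>" and "\<epsilon> \<le> 1 / real CARD('d)"
    and "update_rule M Y R"
    and "x0 \<in> space S" and "\<alpha>0 \<in> Y"
    and "prob_space \<Omega>"
    and "AdapRSMwG M p q R x0 \<alpha>0 \<Omega> (X x0 \<alpha>0)"
    and a: "tendsto_0_in_prob \<Omega> (weight_change R \<alpha>0 (X x0 \<alpha>0))"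
    and b: "\<exists>\<beta>\<in>Y. uniformly_ergodic S (RSG M p \<beta>) \<pi>"
    and c: "\<forall>i.
        (\<forall>z\<in>space (minus_space M i).
           uniformly_ergodic (M i) (metropolis_kernel M p q i z) (cond_kernel M p i z)) \<and>
        (\<exists>s>0. \<exists>m::nat. \<forall>z\<in>space (minus_space M i).
           \<exists>\<nu>. prob_space \<nu> \<and> sets \<nu> = sets (M i) \<and>
             (\<forall>x\<in>space (M i). \<forall>A\<in>sets (M i).
                measure (kernel_pow (M i) (metropolis_kernel M p q i z) m x) A \<ge> s * measure \<nu> A))"
  shows "(\<lambda>n. tv_dist S (distr \<Omega> S (X x0 \<alpha>0 n)) \<pi>) \<longlonglongrightarrow> 0
    \<and> ((\<forall>x\<in>space S. \<forall>a\<in>Y. AdapRSMwG M p q R x a \<Omega> (X x a)) \<longrightarrow>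
       tendsto_0_in_prob \<Omega> (\<lambda>n w. SUP (x, a)\<in>space S \<times> Y. weight_change R a (X x a) n w) \<longrightarrow>
       (\<lambda>n. SUP (x, a)\<in>space S \<times> Y. tv_dist S (distr \<Omega> S (X x a n)) \<pi>) \<longlonglongrightarrow> 0)"
proof -
  interpret \<Omega>: prob_space \<Omega> by fact
  interpret mwg_sampler M \<pi> p q \<epsilon>
    using assms unfolding S_def Y_def by (intro mwg_sampler.intro)
  have runI: "mwg_run M \<pi> p q \<epsilon> \<Omega> R x a (X x a)"
    if "a \<in> Y" "AdapRSMwG M p q R x a \<Omega> (X x a)" for x a
    using that \<open>update_rule M Y R\<close> mwg_sampler_axioms \<Omega>.prob_space_axioms
    by (intro mwg_run.intro mwg_run_axioms.intro) (simp_all add: Y_def)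
  have outer_le_1: "outer_measure_of \<Omega> B \<le> 1" if "B \<subseteq> space \<Omega>" for B
    using outer_measure_of_mono[OF that, of \<Omega>] by (simp add: \<Omega>.emeasure_space_1)
  \<comment> \<open>The exceedance set of a supremum may fail to be measurable, but its outer
    measure dominates the probability of every event inside it. Being at most 1, it can be passed to
    the reals without loss.\<close>
  have outer_real: "enn2real (outer_measure_of \<Omega> B) \<ge> measure \<Omega> C"
    if "C \<subseteq> B" "C \<in> sets \<Omega>" "B \<subseteq> space \<Omega>" for B C
  proof -
    have "emeasure \<Omega> C \<le> outer_measure_of \<Omega> B"
      using outer_measure_of_mono[OF that(1), of \<Omega>] that(2) by simp
    moreover have "outer_measure_of \<Omega> B < top" using outer_le_1[OF that(3)] by (rule order_le_less_trans) simp
    ultimately show ?thesis unfolding measure_def by (rule enn2real_mono)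
  qed
  have in_prob: "(\<lambda>n. enn2real (outer_measure_of \<Omega> {w \<in> space \<Omega>. Z n w > \<eta>})) \<longlonglongrightarrow> 0"
    if "tendsto_0_in_prob \<Omega> Z" "0 < \<eta>" for Z \<eta>
    using that by (intro tendsto_enn2real) (auto simp: tendsto_0_in_prob_def)
  have prob_distr: "prob_space (distr \<Omega> S (X x a n))"
    if "AdapRSMwG M p q R x a \<Omega> (X x a)" for x a n
    using that by (intro \<Omega>.prob_space_distr) (auto simp: AdapRSMwG_def S_def)
  have single: "(\<lambda>n. tv_dist S (distr \<Omega> S (X x0 \<alpha>0 n)) \<pi>) \<longlonglongrightarrow> 0"
  proof (rule LIMSEQ_I)
    fix e :: real assume e: "0 < e"
    interpret run: mwg_run M \<pi> p q \<epsilon> \<Omega> R x0 \<alpha>0 "X x0 \<alpha>0" by (intro runI) fact+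
    define h where "h \<eta> n = enn2real (outer_measure_of \<Omega> {w \<in> space \<Omega>. weight_change R \<alpha>0 (X x0 \<alpha>0) n w > \<eta>})" for \<eta> n
    have h0: "h \<eta> \<longlonglongrightarrow> 0" if "0 < \<eta>" for \<eta>
      unfolding h_def[abs_def] by (rule in_prob[OF a that])
    obtain n0 where n0: "\<forall>n\<ge>n0. \<forall>R x0 \<alpha>0 X. mwg_run M \<pi> p q \<epsilon> \<Omega> R x0 \<alpha>0 X \<longrightarrow>
        (\<forall>\<eta>>0. \<forall>k. measure \<Omega> {w \<in> space \<Omega>. weight_change R \<alpha>0 X k w > \<eta>} \<le> h \<eta> k) \<longrightarrow>
        (\<forall>A\<in>sets S. \<bar>measure (distr \<Omega> S (X n)) A - measure \<pi> A\<bar> \<le> e / 2)"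
      using adaptive_measure_diff_eventually_le[OF h0 half_gt_zero[OF e], where \<Omega>=\<Omega>]
      unfolding S_def by (rule exE)
    have "measure \<Omega> {w \<in> space \<Omega>. weight_change R \<alpha>0 (X x0 \<alpha>0) k w > \<eta>} \<le> h \<eta> k" for \<eta> k
      unfolding h_def using run.big_change_sets by (intro outer_real) (auto simp: run.big_change_def)
    then have "tv_dist S (distr \<Omega> S (X x0 \<alpha>0 n)) \<pi> \<le> e / 2" if "n0 \<le> n" for n
      by (intro tv_dist_le n0[rule_format, OF that run.mwg_run_axioms])
    moreover have "0 \<le> tv_dist S (distr \<Omega> S (X x0 \<alpha>0 n)) \<pi>" for n
      using assms by (intro tv_dist_nonneg prob_distr)
    ultimately show "\<exists>n0. \<forall>n\<ge>n0. norm (tv_dist S (distr \<Omega> S (X x0 \<alpha>0 n)) \<pi> - 0) < e"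
      using e by (intro exI[of _ n0]) (force simp: abs_of_nonneg)
  qed
  have uniform: "(\<lambda>n. SUP (x, a)\<in>space S \<times> Y. tv_dist S (distr \<Omega> S (X x a n)) \<pi>) \<longlonglongrightarrow> 0"
    if runs: "\<forall>x\<in>space S. \<forall>a\<in>Y. AdapRSMwG M p q R x a \<Omega> (X x a)"
      and a': "tendsto_0_in_prob \<Omega> (\<lambda>n w. SUP (x, a)\<in>space S \<times> Y. weight_change R a (X x a) n w)"
  proof (rule LIMSEQ_I)
    fix e :: real assume e: "0 < e"
    define Z where "Z n w = (SUP (x, a)\<in>space S \<times> Y. weight_change R a (X x a) n w)" for n w
    \<comment> \<open>Exceedance by one run implies exceedance by the supremum, so \<open>h\<close>
      bounds the large changes of all runs together and a single \<open>n0\<close> results.\<close>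
    define h where "h \<eta> n = enn2real (outer_measure_of \<Omega> {w \<in> space \<Omega>. Z n w > \<eta>})" for \<eta> n
    have le_Z: "weight_change R a (X x a) n w \<le> Z n w"
      if w: "w \<in> space \<Omega>" and xa: "x \<in> space S" "a \<in> Y" for x a n w
    proof -
      have "weight_change R a (X x a) n w \<le> 2" if xa: "x \<in> space S" "a \<in> Y" for x a
      proof -
        interpret run: mwg_run M \<pi> p q \<epsilon> \<Omega> R x a "X x a" using runs xa by (intro runI) auto
        show ?thesis unfolding run.weight_change
          by (intro norm_prob_simplex_diff_le run.selection_simplex run.weight_in w)
      qed
      then have "bdd_above ((\<lambda>(x, a). weight_change R a (X x a) n w) ` (space S \<times> Y))"
        by (intro bdd_aboveI2[of _ _ 2]) auto
      from cSUP_upper[OF _ this, of "(x, a)"] xa show ?thesis by (simp add: Z_def)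
    qed
    have h0: "h \<eta> \<longlonglongrightarrow> 0" if "0 < \<eta>" for \<eta>
      unfolding h_def[abs_def] using in_prob[OF a' that] by (simp add: Z_def)
    obtain n0 where n0: "\<forall>n\<ge>n0. \<forall>R x0 \<alpha>0 X. mwg_run M \<pi> p q \<epsilon> \<Omega> R x0 \<alpha>0 X \<longrightarrow>
        (\<forall>\<eta>>0. \<forall>k. measure \<Omega> {w \<in> space \<Omega>. weight_change R \<alpha>0 X k w > \<eta>} \<le> h \<eta> k) \<longrightarrow>
        (\<forall>A\<in>sets S. \<bar>measure (distr \<Omega> S (X n)) A - measure \<pi> A\<bar> \<le> e / 2)"
      using adaptive_measure_diff_eventually_le[OF h0 half_gt_zero[OF e], where \<Omega>=\<Omega>]
      unfolding S_def by (rule exE)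
    have tv: "tv_dist S (distr \<Omega> S (X x a n)) \<pi> \<le> e / 2"
      if n: "n0 \<le> n" and xa: "x \<in> space S" "a \<in> Y" for n x a
    proof -
      interpret run: mwg_run M \<pi> p q \<epsilon> \<Omega> R x a "X x a" using runs xa by (intro runI) auto
      have "measure \<Omega> (run.big_change \<eta> k) \<le> h \<eta> k" for \<eta> k
        unfolding h_def using le_Z[OF _ xa]
        by (intro outer_real run.big_change_sets) (auto simp: run.big_change_def intro: order.strict_trans2)
      then show ?thesis
        unfolding run.big_change_def by (intro tv_dist_le n0[rule_format, OF n run.mwg_run_axioms])
    qed
    \<comment> \<open>The given starting values make the index set nonempty; further down, the
      distance at these values also bounds the supremum from below by a nonnegative number.\<close>
    have ne: "space S \<times> Y \<noteq> {}" using assms by blast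
    have "\<bar>SUP (x, a)\<in>space S \<times> Y. tv_dist S (distr \<Omega> S (X x a n)) \<pi>\<bar> \<le> e / 2" if n: "n0 \<le> n" for n
    proof -
      have "(SUP (x, a)\<in>space S \<times> Y. tv_dist S (distr \<Omega> S (X x a n)) \<pi>) \<le> e / 2"
        using ne tv[OF n] by (intro cSUP_least) auto
      moreover have "0 \<le> tv_dist S (distr \<Omega> S (X x0 \<alpha>0 n)) \<pi>"
        using assms by (intro tv_dist_nonneg prob_distr)
      moreover have "tv_dist S (distr \<Omega> S (X x0 \<alpha>0 n)) \<pi> \<le> (SUP (x, a)\<in>space S \<times> Y. tv_dist S (distr \<Omega> S (X x a n)) \<pi>)"
      proof -
        have "bdd_above ((\<lambda>(x, a). tv_dist S (distr \<Omega> S (X x a n)) \<pi>) ` (space S \<times> Y))"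
          using tv[OF n] by (intro bdd_aboveI2[of _ _ "e / 2"]) auto
        from cSUP_upper[OF _ this, of "(x0, \<alpha>0)"] assms show ?thesis by simp
      qed
      ultimately show ?thesis by linarith
    qed
    then show "\<exists>n0. \<forall>n\<ge>n0. norm ((SUP (x, a)\<in>space S \<times> Y. tv_dist S (distr \<Omega> S (X x a n)) \<pi>) - 0) < e"
      using e by (intro exI[of _ n0]) (force)
  qed
  show ?thesis using single uniform by blast
qed

end
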